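(* For every universal prefix-free Turing machine $U$, the halting probability $\Omega_U=\sum_{p\in\mathrm{dom}(U)}2^{-|p|}$ does not belong to $\mathrm{EML}_{\mathbb{R}}$; that is, there is no closed EML expression $\varphi$ with $[\![\varphi]\!]$ defined and $[\![\varphi]\!]=\Omega_U$.
   Context: Closed EML expressions form the smallest set $\mathcal{E}$ of strings over the alphabet $\{1, E, (, ), ,\}$ such that the string $1\in\mathcal{E}$, and if $\alpha,\beta\in\mathcal{E}$ then the string $E(\alpha,\beta)\in\mathcal{E}$. Their value $[\![\cdot]\!]$ is defined recursively by $[\![1]\!]=1$ and $[\![E(\alpha,\beta)]\!]=\exp([\![\alpha]\!])-\log([\![\beta]\!])$, where $\log$ is the principal branch of the complex natural logarithm on $\mathbb{C}\setminus\{0\}$, with imaginary part in $(-\pi,\pi]$. The value $[\![E(\alpha,\beta)]\!]$ is defined exactly when $[\![\alpha]\!]$ and $[\![\beta]\!]$ are defined and $[\![\beta]\!]\neq 0$. Let $\mathrm{EML}=\{[\![\varphi]\!]:\varphi\in\mathcal{E},\ [\![\varphi]\!]\text{ defined}\}$ and $\mathrm{EML}_{\mathbb{R}}=\mathrm{EML}\cap\mathbb{R}$. In $\Omega_U$, $\mathrm{dom}(U)$ is the set of binary programs on which $U$ halts and $|p|$ is the length of $p$. *)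

theory Defs
  imports "HOL-Analysis.Analysis" "HOL-Library.Sublist"
begin

section \<open>Closed EML expressions\<close>

text \<open>The terms of this type are in bijection with the strings generated by the symbol \<open>1\<close> and the
  rule \<open>\<alpha>, \<beta> \<mapsto> E(\<alpha>,\<beta>)\<close>, since that grammar is uniquely readable.\<close>

datatype eml = One | E eml eml

text \<open>The value is \<^term>\<open>None\<close> where it is undefined. On the complex numbers \<^term>\<open>ln\<close> is the principal
  branch, with imaginary part in \<open>(-\<pi>, \<pi>]\<close>; its junk value at 0 is never used.\<close>

fun eml_value :: "eml \<Rightarrow> complex option" where
  "eml_value One = Some 1"
| "eml_value (E \<alpha> \<beta>) =
     (case (eml_value \<alpha>, eml_value \<beta>) of
        (Some a, Some b) \<Rightarrow> if b = 0 then None else Some (exp a - ln b)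
      | _ \<Rightarrow> None)"

definition EML :: "complex set" where
  "EML = {z. \<exists>\<phi>. eml_value \<phi> = Some z}"

definition EML_R :: "complex set" where
  "EML_R = EML \<inter> \<real>"


section \<open>Turing machines\<close>

text \<open>Deterministic Turing machines with finitely many two-way infinite tapes. The states are the
  numbers below \<open>nstates\<close>, with initial state 0 and halting state 1; the tape symbols are the
  numbers below \<open>nsyms\<close>, where 0 is the blank and 1, 2 encode the bits 0, 1. Given the state and
  the scanned symbols, one for each tape, \<open>delta\<close> yields the next state and, for each tape, the symbol to be
  written and the head movement.\<close>

datatype move = MoveLeft | Stay | MoveRight

record tm =
  ntapes :: nat
  nstates :: nat
  nsyms :: nat
  delta :: "nat \<Rightarrow> nat list \<Rightarrow> nat \<times> (nat \<times> move) list"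

definition wf_tm :: "tm \<Rightarrow> bool" where
  "wf_tm M \<longleftrightarrow> ntapes M \<ge> 1 \<and> nstates M \<ge> 2 \<and> nsyms M \<ge> 3 \<and>
     (\<forall>q ss. q < nstates M \<and> q \<noteq> 1 \<and> length ss = ntapes M \<and> (\<forall>s\<in>set ss. s < nsyms M) \<longrightarrow>
        fst (delta M q ss) < nstates M \<and>
        length (snd (delta M q ss)) = ntapes M \<and>
        (\<forall>(s, d)\<in>set (snd (delta M q ss)). s < nsyms M))"

text \<open>A tape is given by its cell contents and the position of its head.\<close>

type_synonym tape = "(int \<Rightarrow> nat) \<times> int"
type_synonym config = "nat \<times> tape list"

fun move_head :: "move \<Rightarrow> int \<Rightarrow> int" where
  "move_head MoveLeft i = i - 1"
| "move_head Stay i = i"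
| "move_head MoveRight i = i + 1"

fun update_tape :: "nat \<times> move \<Rightarrow> tape \<Rightarrow> tape" where
  "update_tape (s, d) (c, i) = (c(i := s), move_head d i)"

fun tm_step :: "tm \<Rightarrow> config \<Rightarrow> config" where
  "tm_step M (q, ts) =
     (if q = 1 then (q, ts)
      else let (q', as) = delta M q (map (\<lambda>(c, i). c i) ts) in (q', map2 update_tape as ts))"

definition blank_tape :: tape where
  "blank_tape = ((\<lambda>_. 0), 0)"

definition input_tape :: "bool list \<Rightarrow> tape" where
  "input_tape p =
     ((\<lambda>i. if 0 \<le> i \<and> i < int (length p) then (if p ! nat i then 2 else 1) else 0), 0)"

definition tm_init :: "tm \<Rightarrow> bool list \<Rightarrow> config" where
  "tm_init M p = (0, input_tape p # replicate (ntapes M - 1) blank_tape)"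

definition tm_run :: "tm \<Rightarrow> bool list \<Rightarrow> nat \<Rightarrow> config" where
  "tm_run M p t = (tm_step M ^^ t) (tm_init M p)"

definition tm_dom :: "tm \<Rightarrow> bool list set" where
  "tm_dom M = {p. \<exists>t. fst (tm_run M p t) = 1}"

text \<open>The output is the maximal block of bits on the last tape that starts at cell 0. (The first
  tape carries the input; with a single tape, the two coincide.) The block is finite, since only
  finitely many cells are ever non-blank.\<close>

definition read_tape :: "tape \<Rightarrow> bool list" where
  "read_tape T = map (\<lambda>i. fst T (int i) = 2) [0..<(LEAST n. fst T (int n) \<notin> {1, 2})]"

definition tm_output :: "tm \<Rightarrow> bool list \<Rightarrow> bool list option" where
  "tm_output M p =
     (if p \<in> tm_dom M
      then Some (read_tape (last (snd (tm_run M p (LEAST t. fst (tm_run M p t) = 1)))))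
      else None)"


section \<open>Universal prefix-free machines and the halting probability\<close>

definition prefix_free_tm :: "tm \<Rightarrow> bool" where
  "prefix_free_tm M \<longleftrightarrow> wf_tm M \<and> (\<forall>p\<in>tm_dom M. \<forall>q\<in>tm_dom M. prefix p q \<longrightarrow> p = q)"

text \<open>Universality in the sense of Chaitin and Calude: every prefix-free machine is simulated up to
  an additive constant in program length. Machines that are universal by adjunction, i.e. for which
  every prefix-free \<open>M\<close> admits a string \<open>r\<close> such that \<open>U\<close> on \<open>r @ p\<close> behaves as \<open>M\<close> on \<open>p\<close>,
  are included: take \<open>q = r @ p\<close> and \<open>k = length r\<close>.\<close>

definition universal_prefix_free_tm :: "tm \<Rightarrow> bool" where
  "universal_prefix_free_tm U \<longleftrightarrow> prefix_free_tm U \<and>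
     (\<forall>M. prefix_free_tm M \<longrightarrow>
        (\<exists>k. \<forall>p\<in>tm_dom M. \<exists>q\<in>tm_dom U.
           tm_output U q = tm_output M p \<and> length q \<le> length p + k))"

text \<open>The sum converges for every prefix-free machine, by Kraft's inequality.\<close>

definition halting_probability :: "tm \<Rightarrow> real" where
  "halting_probability U = (\<Sum>\<^sub>\<infinity>p\<in>tm_dom U. 1 / 2 ^ length p)"

end

theory Submission
  imports Defs "HOL-Library.Nat_Bijection"
begin

text \<open>By induction, the value of every closed EML expression is a computable complex number. The case
  distinctions hidden in the principal branch are harmless, since only the existence of an algorithm for
  each fixed expression matters: \<open>ln b\<close> differs from a fixed Gaussian rational \<open>w\<close> by the logarithm of
  \<open>b * exp (- w)\<close>, which can be taken close to 1 and hence evaluated by the power series.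

  If \<open>\<Omega>\<^sub>U\<close> were computable, then, as the sum over the programs that halt within \<open>t\<close> steps tends to
  \<open>\<Omega>\<^sub>U\<close>, one could compute from \<open>m\<close> a time \<open>T m\<close> by which the sum is within \<open>4\<^sup>-\<^sup>m\<close> of its limit, so that
  every program of length at most \<open>2m\<close> that halts at all has halted; its output then has length at most
  \<open>2m + T m\<close>. A prefix-free machine that on input \<open>1\<^sup>m0\<close> produces an output of length greater than
  \<open>2m + T m\<close> cannot be simulated by \<open>U\<close> up to an additive constant in program length. That machine is obtained
  by compiling recursive functions to counter programs, whose variables are kept on separate tapes.\<close>

section \<open>Recursive functions and computability on numbered types\<close>

text \<open>Two translations between models of computation are needed. Universality quantifies over
  Turing machines only, so the fast growing function has to become a machine; and that function
  inspects runs of \<open>U\<close>, so Turing machines have to be simulated by recursive functions.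
  All functions involved are total: a search is made only where a witness is known to exist, and
  runs are cut off at a time bound. The code 1...10 of m is wasteful, but prefix-free for a trivial
  reason, and its length m + 1 leaves room: m + 1 + k is at most 2m as soon as m exceeds k, whatever
  the simulation constant k of \<open>U\<close> is. Outputs are compared by length alone.\<close>

text \<open>Unary functions are enough because several arguments are packed by
  \<open>prod_encode\<close>; \<open>iter\<close> takes the place of primitive recursion. The
  premise of \<open>least\<close> that a zero always exists keeps every member total.\<close>

inductive recf :: "(nat \<Rightarrow> nat) \<Rightarrow> bool" where
  zero: "recf (\<lambda>_. 0)"
| Suc: "recf Suc"
| fst: "recf (\<lambda>n. fst (prod_decode n))"
| snd: "recf (\<lambda>n. snd (prod_decode n))"
| comp: "recf f \<Longrightarrow> recf g \<Longrightarrow> recf (\<lambda>n. f (g n))"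
| pair: "recf f \<Longrightarrow> recf g \<Longrightarrow> recf (\<lambda>n. prod_encode (f n, g n))"
| iter: "recf f \<Longrightarrow> recf (\<lambda>n. (f ^^ snd (prod_decode n)) (fst (prod_decode n)))"
| least: "recf f \<Longrightarrow> (\<And>x. \<exists>k. f (prod_encode (x, k)) = 0) \<Longrightarrow>
    recf (\<lambda>x. LEAST k. f (prod_encode (x, k)) = 0)"

lemma recf_id: "recf (\<lambda>n. n)"
  using recf.pair[OF recf.fst recf.snd] by simp

lemma recf_const: "recf (\<lambda>_. c)"
  by (induction c) (auto intro: recf.zero recf.comp[OF recf.Suc])

text \<open>The numbering \<open>num\<close> need neither be injective nor surjective. In particular, on the complex numbers it
  only reaches the Gaussian rationals, and computability constrains a function at these arguments only.\<close>

class numbered =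
  fixes num :: "nat \<Rightarrow> 'a"

instantiation nat :: numbered
begin
definition num_nat :: "nat \<Rightarrow> nat" where "num_nat n = n"
instance ..
end

instantiation prod :: (numbered, numbered) numbered
begin
definition num_prod :: "nat \<Rightarrow> 'a \<times> 'b" where "num_prod n = map_prod num num (prod_decode n)"
instance ..
end

instantiation list :: (numbered) numbered
begin
definition num_list :: "nat \<Rightarrow> 'a list" where "num_list n = map num (list_decode n)"
instance ..
end

definition computable :: "('a::numbered \<Rightarrow> 'b::numbered) \<Rightarrow> bool" where
  "computable f \<longleftrightarrow> (\<exists>g. recf g \<and> (\<forall>n. num (g n) = f (num n)))"

lemma computableI: "recf g \<Longrightarrow> (\<And>n. num (g n) = f (num n)) \<Longrightarrow> computable f"
  by (auto simp: computable_def)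

lemma computableE:
  assumes "computable f"
  obtains g where "recf g" "\<And>n. num (g n) = f (num n)"
  using assms by (auto simp: computable_def)

lemma computable_nat_iff: "computable (f :: nat \<Rightarrow> nat) \<longleftrightarrow> recf f"
proof -
  have "(\<exists>g. recf g \<and> (\<forall>n. g n = f n)) \<longleftrightarrow> recf f"
    by (metis ext)
  then show ?thesis by (simp add: computable_def num_nat_def)
qed

named_theorems computable_intros

lemma computable_id [computable_intros]: "computable (\<lambda>x. x)"
  by (rule computableI[OF recf_id]) simp

text \<open>Restricted to values of \<open>num\<close>, since a constant without a code, such as a
  complex number that is not a Gaussian rational, is not computable in this sense.\<close>

lemma computable_num: "computable (\<lambda>_. num c)"
  by (rule computableI[OF recf_const]) simp

lemma computable_const_nat [computable_intros]: "computable (\<lambda>_. c :: nat)"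
  using computable_num[of c, where 'b = nat] by (simp add: num_nat_def)

lemma computable_comp: "computable f \<Longrightarrow> computable g \<Longrightarrow> computable (\<lambda>x. f (g x))"
  unfolding computable_def by (metis recf.comp)

lemma computable_Pair [computable_intros]:
  assumes "computable f" "computable g"
  shows "computable (\<lambda>x. (f x, g x))"
proof -
  obtain f' g' where "recf f'" "\<And>n. num (f' n) = f (num n)" "recf g'" "\<And>n. num (g' n) = g (num n)"
    using assms unfolding computable_def by metis
  then show ?thesis
    by (intro computableI[OF recf.pair[of f' g']]) (auto simp: num_prod_def)
qed

lemma computable_fst [computable_intros]:
  assumes "computable f"
  shows "computable (\<lambda>x. fst (f x))"
proof -
  have "computable (fst :: 'b \<times> 'c \<Rightarrow> 'b)"
    by (rule computableI[OF recf.fst]) (simp add: num_prod_def)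
  then show ?thesis using assms by (rule computable_comp)
qed

lemma computable_snd [computable_intros]:
  assumes "computable f"
  shows "computable (\<lambda>x. snd (f x))"
proof -
  have "computable (snd :: 'b \<times> 'c \<Rightarrow> 'c)"
    by (rule computableI[OF recf.snd]) (simp add: num_prod_def)
  then show ?thesis using assms by (rule computable_comp)
qed

lemma computable_Suc [computable_intros]:
  assumes "computable f"
  shows "computable (\<lambda>x. Suc (f x))"
  by (rule computable_comp[OF _ assms]) (simp add: computable_nat_iff recf.Suc)

lemma computable_funpow:
  fixes F :: "'b::numbered \<Rightarrow> 'b"
  assumes F: "computable F" and "computable a" "computable n"
  shows "computable (\<lambda>x. (F ^^ n x) (a x))"
proof -
  obtain f where f: "recf f" "\<And>m. num (f m) = F (num m)"
    using F by (rule computableE) blast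
  have "num ((f ^^ k) m) = (F ^^ k) (num m)" for k m
    by (induction k) (simp_all add: f(2))
  then have "computable (\<lambda>p. (F ^^ snd p) (fst p))"
    by (intro computableI[OF recf.iter[OF f(1)]]) (simp add: num_prod_def num_nat_def)
  from computable_comp[OF this computable_Pair[OF assms(2,3)]] show ?thesis by simp
qed

text \<open>\<open>computable_funpow\<close> iterates one fixed function; a step that depends on a
  parameter is reduced to it by carrying the parameter along in the state.\<close>

lemma computable_iterate [computable_intros]:
  fixes F :: "'a::numbered \<Rightarrow> 'b::numbered \<Rightarrow> 'b"
  assumes F: "computable (\<lambda>p. F (fst p) (snd p))" and a: "computable a" and n: "computable n"
  shows "computable (\<lambda>x. (F x ^^ n x) (a x))"
proof -
  define G where "G p = (fst p, F (fst p) (snd p))" for p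
  have "(G ^^ k) (x, y) = (x, (F x ^^ k) y)" for k x y
    by (induction k) (simp_all add: G_def)
  then have "(\<lambda>x. (F x ^^ n x) (a x)) = (\<lambda>x. snd ((G ^^ n x) (x, a x)))" by simp
  moreover have "computable G"
    unfolding G_def by (intro computable_intros F)
  ultimately show ?thesis
    by (auto intro!: computable_intros computable_funpow a n)
qed

section \<open>Decidable predicates and arithmetic\<close>

definition decidable :: "('a::numbered \<Rightarrow> bool) \<Rightarrow> bool" where
  "decidable P \<longleftrightarrow> computable (\<lambda>x. of_bool (P x) :: nat)"

lemma computable_If [computable_intros]:
  assumes "decidable P" "computable f" "computable g"
  shows "computable (\<lambda>x. if P x then f x else g x)"
proof -
  \<comment> \<open>Branching as iteration: a step that overwrites the second component by the first
    is performed once or not at all.\<close>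
  have "(\<lambda>x. if P x then f x else g x) =
      (\<lambda>x. snd (((\<lambda>p. (fst p, fst p)) ^^ of_bool (P x)) (f x, g x)))"
    by auto
  then show ?thesis
    using assms by (auto simp: decidable_def intro!: computable_intros)
qed

lemma computable_add [computable_intros]:
  assumes "computable f" "computable g"
  shows "computable (\<lambda>x. f x + g x :: nat)"
proof -
  have "computable (\<lambda>x. (Suc ^^ g x) (f x))"
    using assms by (intro computable_intros)
  moreover have "(Suc ^^ k) m = m + k" for k m
    by (induction k) simp_all
  ultimately show ?thesis by (simp only:)
qed

lemma computable_mult [computable_intros]:
  assumes "computable f" "computable g"
  shows "computable (\<lambda>x. f x * g x :: nat)"
proof -
  have "computable (\<lambda>x. ((\<lambda>a. a + f x) ^^ g x) 0)"
    using assms by (intro computable_intros computable_comp[OF assms(1)])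
  moreover have "((\<lambda>a. a + m) ^^ k) 0 = m * k" for k m :: nat
    by (induction k) simp_all
  ultimately show ?thesis by simp
qed

lemma computable_pred:
  assumes "computable f"
  shows "computable (\<lambda>x. f x - Suc 0)"
proof -
  \<comment> \<open>An iterated step does not see its index, so the state holds the index together
    with its predecessor.\<close>
  have "computable (\<lambda>x. fst (((\<lambda>p. (snd p, Suc (snd p))) ^^ f x) (0 :: nat, 0)))"
    using assms by (intro computable_intros)
  moreover have "((\<lambda>p. (snd p, Suc (snd p))) ^^ k) (0 :: nat, 0) = (k - Suc 0, k)" for k
    by (induction k) simp_all
  ultimately show ?thesis by simp
qed

lemma computable_diff [computable_intros]:
  assumes "computable f" "computable g"
  shows "computable (\<lambda>x. f x - g x :: nat)"
proof -
  have "computable (\<lambda>x. ((\<lambda>a. a - Suc 0) ^^ g x) (f x))"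
    using assms by (intro computable_intros computable_pred)
  moreover have "((\<lambda>a. a - Suc 0) ^^ k) m = m - k" for k m
    by (induction k) simp_all
  ultimately show ?thesis by simp
qed

lemma decidable_less [computable_intros]:
  assumes "computable f" "computable g"
  shows "decidable (\<lambda>x. f x < (g x :: nat))"
proof -
  have "computable (\<lambda>x. 1 - (1 - (g x - f x)))"
    using assms by (intro computable_intros)
  moreover have "1 - (1 - (g x - f x)) = of_bool (f x < g x)" for x
    by auto
  ultimately show ?thesis by (simp add: decidable_def)
qed

lemma decidable_not [computable_intros]:
  assumes "decidable P"
  shows "decidable (\<lambda>x. \<not> P x)"
proof -
  have "computable (\<lambda>x. 1 - of_bool (P x) :: nat)"
    using assms by (intro computable_intros) (simp add: decidable_def)
  moreover have "1 - of_bool (P x) = (of_bool (\<not> P x) :: nat)" for x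
    by auto
  ultimately show ?thesis by (simp add: decidable_def)
qed

lemma decidable_conj [computable_intros]:
  assumes "decidable P" "decidable Q"
  shows "decidable (\<lambda>x. P x \<and> Q x)"
proof -
  have "computable (\<lambda>x. of_bool (P x) * of_bool (Q x) :: nat)"
    using assms by (intro computable_intros) (simp_all add: decidable_def)
  then show ?thesis by (simp add: decidable_def of_bool_conj)
qed

lemma decidable_eq [computable_intros]:
  assumes "computable f" "computable g"
  shows "decidable (\<lambda>x. f x = (g x :: nat))"
proof -
  have "(\<lambda>x. f x = g x) = (\<lambda>x. \<not> f x < g x \<and> \<not> g x < f x)" by auto
  then show ?thesis using assms by (auto intro!: computable_intros)
qed

lemma computable_Least [computable_intros]:
  fixes P :: "'a::numbered \<Rightarrow> nat \<Rightarrow> bool"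
  assumes P: "decidable (\<lambda>p. P (fst p) (snd p))" and ex: "\<And>x. \<exists>k. P x k"
  shows "computable (\<lambda>x. LEAST k. P x k)"
proof -
  have "computable (\<lambda>p. of_bool (\<not> P (fst p) (snd p)) :: nat)"
    using decidable_not[OF P] by (simp add: decidable_def)
  then obtain f where f: "recf f" "\<And>m. f m = (of_bool (\<not> P (fst (num m :: 'a \<times> nat)) (snd (num m :: 'a \<times> nat))) :: nat)"
    unfolding computable_def num_nat_def by blast
  have *: "f (prod_encode (x, k)) = 0 \<longleftrightarrow> P (num x) k" for x k
    by (simp add: f(2) num_prod_def num_nat_def)
  show ?thesis
    by (rule computableI[OF recf.least[OF f(1)]]) (auto simp: * ex num_nat_def)
qed

text \<open>A finite table is recursive by adding its entries one at a time as case distinctions.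
  This is what makes transition functions computable later.\<close>

lemma recf_finite_support:
  assumes "finite {n. g n \<noteq> 0}"
  shows "recf g"
proof -
  have "computable (\<lambda>n. if n \<in> A then g n else 0)" if "finite A" for A
    using that
  proof induction
    case empty
    show ?case by (simp add: computable_intros)
  next
    case (insert a A)
    have "(\<lambda>n. if n \<in> insert a A then g n else 0) = (\<lambda>n. if n = a then g a else if n \<in> A then g n else 0)"
      by auto
    then show ?case using insert.IH by (auto intro!: computable_intros)
  qed
  from this[OF assms] have "computable (\<lambda>n. if n \<in> {n. g n \<noteq> 0} then g n else 0)" .
  moreover have "(\<lambda>n. if n \<in> {n. g n \<noteq> 0} then g n else 0) = g" by auto
  ultimately show ?thesis by (simp only: computable_nat_iff)
qed

section \<open>Counter programs\<close>

datatype com = Inc nat | Dec nat | Seq com com (infixr ";;" 60) | While nat com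

type_synonym store = "nat \<Rightarrow> nat"

inductive exec :: "com \<Rightarrow> store \<Rightarrow> store \<Rightarrow> bool" where
  Inc: "exec (Inc x) \<sigma> (\<sigma>(x := Suc (\<sigma> x)))"
| Dec: "exec (Dec x) \<sigma> (\<sigma>(x := \<sigma> x - 1))"
| Seq: "exec c \<sigma> \<sigma>' \<Longrightarrow> exec d \<sigma>' \<sigma>'' \<Longrightarrow> exec (c ;; d) \<sigma> \<sigma>''"
| While_0: "\<sigma> x = 0 \<Longrightarrow> exec (While x c) \<sigma> \<sigma>"
| While_Suc: "\<sigma> x \<noteq> 0 \<Longrightarrow> exec c \<sigma> \<sigma>' \<Longrightarrow> exec (While x c) \<sigma>' \<sigma>'' \<Longrightarrow> exec (While x c) \<sigma> \<sigma>''"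

lemma exec_eq: "exec c \<sigma> \<tau> \<Longrightarrow> \<tau> = \<sigma>' \<Longrightarrow> exec c \<sigma> \<sigma>'"
  by simp

lemma exec_Inc: "\<sigma>' = \<sigma>(x := Suc (\<sigma> x)) \<Longrightarrow> exec (Inc x) \<sigma> \<sigma>'"
  by (simp add: exec.Inc)

lemma exec_Dec: "\<sigma>' = \<sigma>(x := \<sigma> x - 1) \<Longrightarrow> exec (Dec x) \<sigma> \<sigma>'"
  by (simp add: exec.Dec del: One_nat_def)

definition Clear :: "nat \<Rightarrow> com" where
  "Clear x = While x (Dec x)"

lemma exec_Clear: "exec (Clear x) \<sigma> (\<sigma>(x := 0))"
proof (induction "\<sigma> x" arbitrary: \<sigma>)
  case 0
  then show ?case using exec.While_0[of \<sigma> x "Dec x"] by (simp add: Clear_def fun_upd_idem)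
next
  case (Suc n)
  have "exec (Clear x) (\<sigma>(x := n)) (\<sigma>(x := 0))"
    using Suc.hyps(1)[of "\<sigma>(x := n)"] by simp
  moreover have "exec (Dec x) \<sigma> (\<sigma>(x := n))"
    using Suc.hyps(2) by (intro exec_Dec) (metis diff_Suc_1)
  ultimately show ?case
    using Suc.hyps(2) by (auto simp: Clear_def intro: exec.While_Suc)
qed

text \<open>A variable can be read only by emptying it. Filling two targets at once leaves one copy
  from which \<open>Copy\<close> and \<open>Encode\<close> restore it.\<close>

lemma exec_transfer_loop:
  assumes "distinct [x, y, z]"
  shows "exec (While x (Dec x ;; Inc y ;; Inc z)) \<sigma> (\<sigma>(x := 0, y := \<sigma> y + \<sigma> x, z := \<sigma> z + \<sigma> x))"
proof (induction "\<sigma> x" arbitrary: \<sigma>)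
  case 0
  then have "\<sigma> x = 0" by simp
  then have "\<sigma>(x := 0, y := \<sigma> y + \<sigma> x, z := \<sigma> z + \<sigma> x) = \<sigma>" by auto
  with \<open>\<sigma> x = 0\<close> exec.While_0[of \<sigma> x] show ?case by metis
next
  case (Suc n)
  let ?\<sigma> = "\<sigma>(x := n, y := Suc (\<sigma> y), z := Suc (\<sigma> z))"
  have "exec (Dec x ;; Inc y ;; Inc z) \<sigma> ?\<sigma>"
    using Suc.hyps(2)[symmetric] assms by (intro exec.Seq exec_Dec exec_Inc refl) auto
  moreover have "exec (While x (Dec x ;; Inc y ;; Inc z)) ?\<sigma> (\<sigma>(x := 0, y := \<sigma> y + \<sigma> x, z := \<sigma> z + \<sigma> x))"
    using Suc.hyps(1)[of ?\<sigma>] Suc.hyps(2)[symmetric] assms by (simp add: fun_upd_twist)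
  ultimately show ?case
    using Suc.hyps(2) by (auto intro: exec.While_Suc)
qed

lemma exec_move_loop:
  assumes "x \<noteq> y"
  shows "exec (While x (Dec x ;; Inc y)) \<sigma> (\<sigma>(x := 0, y := \<sigma> y + \<sigma> x))"
proof (induction "\<sigma> x" arbitrary: \<sigma>)
  case 0
  then have "\<sigma> x = 0" by simp
  then have "\<sigma>(x := 0, y := \<sigma> y + \<sigma> x) = \<sigma>" by auto
  with \<open>\<sigma> x = 0\<close> exec.While_0[of \<sigma> x] show ?case by metis
next
  case (Suc n)
  let ?\<sigma> = "\<sigma>(x := n, y := Suc (\<sigma> y))"
  have "exec (Dec x ;; Inc y) \<sigma> ?\<sigma>"
    using Suc.hyps(2)[symmetric] assms by (intro exec.Seq exec_Dec exec_Inc refl) auto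
  moreover have "exec (While x (Dec x ;; Inc y)) ?\<sigma> (\<sigma>(x := 0, y := \<sigma> y + \<sigma> x))"
    using Suc.hyps(1)[of ?\<sigma>] Suc.hyps(2)[symmetric] assms by (simp add: fun_upd_twist)
  ultimately show ?case
    using Suc.hyps(2) by (auto intro: exec.While_Suc)
qed

definition Move :: "nat \<Rightarrow> nat \<Rightarrow> com" where
  "Move x y = Clear y ;; While x (Dec x ;; Inc y)"

lemma exec_Move: "x \<noteq> y \<Longrightarrow> exec (Move x y) \<sigma> (\<sigma>(x := 0, y := \<sigma> x))"
  unfolding Move_def
  by (rule exec.Seq[OF exec_Clear], rule exec_eq[OF exec_move_loop]) auto

definition Copy :: "nat \<Rightarrow> nat \<Rightarrow> nat \<Rightarrow> com" where
  "Copy x y t = Clear y ;; Clear t ;; While x (Dec x ;; Inc y ;; Inc t) ;; Move t x"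

lemma exec_Copy:
  assumes "distinct [x, y, t]"
  shows "exec (Copy x y t) \<sigma> (\<sigma>(y := \<sigma> x, t := 0))"
proof -
  let ?\<tau> = "\<sigma>(y := 0, t := 0)"
  have "exec (While x (Dec x ;; Inc y ;; Inc t)) ?\<tau> (?\<tau>(x := 0, y := ?\<tau> y + ?\<tau> x, t := ?\<tau> t + ?\<tau> x))"
    using assms by (rule exec_transfer_loop)
  then have "exec (While x (Dec x ;; Inc y ;; Inc t)) ?\<tau> (\<sigma>(x := 0, y := \<sigma> x, t := \<sigma> x))"
    by (rule exec_eq) (use assms in auto)
  moreover have "exec (Move t x) (\<sigma>(x := 0, y := \<sigma> x, t := \<sigma> x)) (\<sigma>(y := \<sigma> x, t := 0))"
    by (rule exec_eq[OF exec_Move]) (use assms in auto)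
  ultimately show ?thesis
    unfolding Copy_def by (blast intro: exec.Seq exec_Clear)
qed

text \<open>A conditional made of loops that run at most once: \<open>t\<close> is a copy of
  \<open>x\<close> and \<open>e\<close> is 1. The first branch clears both flags and thereby
  disables the second; neither branch may leave its own flag set.\<close>

definition If_pos :: "nat \<Rightarrow> nat \<Rightarrow> nat \<Rightarrow> com \<Rightarrow> com \<Rightarrow> com" where
  "If_pos x t e c d = Copy x t e ;; Inc e ;; While t (Clear t ;; Clear e ;; c) ;; While e (Clear e ;; d)"

lemma exec_If_pos:
  assumes "distinct [x, t, e]"
    and c: "\<sigma> x \<noteq> 0 \<Longrightarrow> exec c (\<sigma>(t := 0, e := 0)) \<tau>"
    and d: "\<sigma> x = 0 \<Longrightarrow> exec d (\<sigma>(t := 0, e := 0)) \<tau>"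
    and "\<tau> t = 0" "\<tau> e = 0"
  shows "exec (If_pos x t e c d) \<sigma> \<tau>"
proof -
  let ?\<rho> = "\<sigma>(t := \<sigma> x, e := 1)"
  have 1: "exec (Copy x t e) \<sigma> (\<sigma>(t := \<sigma> x, e := 0))" "exec (Inc e) (\<sigma>(t := \<sigma> x, e := 0)) ?\<rho>"
    using assms(1) by (auto intro: exec_Copy exec_Inc)
  have 2: "\<exists>\<rho>. exec (While t (Clear t ;; Clear e ;; c)) ?\<rho> \<rho> \<and> exec (While e (Clear e ;; d)) \<rho> \<tau>"
  proof (cases "\<sigma> x = 0")
    case True
    have "exec (While t (Clear t ;; Clear e ;; c)) ?\<rho> ?\<rho>"
      using True assms(1) by (intro exec.While_0) auto
    moreover have "exec (Clear e) ?\<rho> (\<sigma>(t := 0, e := 0))"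
      by (rule exec_eq[OF exec_Clear]) (use True in auto)
    then have "exec (Clear e ;; d) ?\<rho> \<tau>"
      using d[OF True] by (rule exec.Seq)
    then have "exec (While e (Clear e ;; d)) ?\<rho> \<tau>"
      by (rule exec.While_Suc[rotated]) (use assms(1,5) in \<open>auto intro: exec.While_0\<close>)
    ultimately show ?thesis by blast
  next
    case False
    have "exec (Clear t) ?\<rho> (\<sigma>(t := 0, e := 1))"
      by (rule exec_eq[OF exec_Clear]) (use assms(1) in auto)
    moreover have "exec (Clear e) (\<sigma>(t := 0, e := 1)) (\<sigma>(t := 0, e := 0))"
      by (rule exec_eq[OF exec_Clear]) auto
    ultimately have "exec (Clear t ;; Clear e ;; c) ?\<rho> \<tau>"
      using c[OF False] by (blast intro: exec.Seq)
    then have "exec (While t (Clear t ;; Clear e ;; c)) ?\<rho> \<tau>"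
      by (rule exec.While_Suc[rotated]) (use False assms(1,4) in \<open>auto intro: exec.While_0\<close>)
    moreover have "exec (While e (Clear e ;; d)) \<tau> \<tau>"
      using assms(5) by (intro exec.While_0)
    ultimately show ?thesis by blast
  qed
  show ?thesis
    using 1 2 unfolding If_pos_def by (blast intro: exec.Seq)
qed

text \<open>Computes the Cantor pairing \<open>triangle (m + n) + m\<close>: after the first loop
  \<open>x + 1\<close> holds m + n and \<open>x + 2\<close> holds m; then m + n, m + n - 1, ..., 1
  are added to \<open>x + 2\<close>, with \<open>x + 3\<close> as backup.\<close>

definition Encode :: "nat \<Rightarrow> com" where
  "Encode x = Clear (x + 2) ;; Clear (x + 3) ;; While x (Dec x ;; Inc (x + 1) ;; Inc (x + 2)) ;;
     While (x + 1) (While (x + 1) (Dec (x + 1) ;; Inc (x + 2) ;; Inc (x + 3)) ;; Move (x + 3) (x + 1) ;; Dec (x + 1))"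

lemma exec_Encode:
  "exec (Encode x) \<sigma> (\<sigma>(x := 0, x + 1 := 0, x + 2 := prod_encode (\<sigma> x, \<sigma> (x + 1)), x + 3 := 0))"
proof -
  let ?body = "While (x + 1) (Dec (x + 1) ;; Inc (x + 2) ;; Inc (x + 3)) ;; Move (x + 3) (x + 1) ;; Dec (x + 1)"
  have loop: "exec (While (x + 1) ?body) \<sigma> (\<sigma>(x + 1 := 0, x + 2 := \<sigma> (x + 2) + triangle (\<sigma> (x + 1))))"
    if "\<sigma> (x + 3) = 0" for \<sigma>
    using that
  proof (induction "\<sigma> (x + 1)" arbitrary: \<sigma>)
    case 0
    then have "\<sigma>(x + 1 := 0, x + 2 := \<sigma> (x + 2) + triangle (\<sigma> (x + 1))) = \<sigma>"
      by (auto simp: fun_eq_iff)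
    with 0 exec.While_0[of \<sigma> "x + 1"] show ?case by metis
  next
    case (Suc k)
    note k = Suc.hyps(2)[symmetric]
    let ?\<sigma> = "\<sigma>(x + 1 := k, x + 2 := \<sigma> (x + 2) + Suc k)"
    have "exec (While (x + 1) (Dec (x + 1) ;; Inc (x + 2) ;; Inc (x + 3))) \<sigma>
        (\<sigma>(x + 1 := 0, x + 2 := \<sigma> (x + 2) + Suc k, x + 3 := Suc k))"
      by (rule exec_eq[OF exec_transfer_loop]) (use k Suc.prems in auto)
    moreover have "exec (Move (x + 3) (x + 1)) (\<sigma>(x + 1 := 0, x + 2 := \<sigma> (x + 2) + Suc k, x + 3 := Suc k))
        (\<sigma>(x + 1 := Suc k, x + 2 := \<sigma> (x + 2) + Suc k, x + 3 := 0))"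
      by (rule exec_eq[OF exec_Move]) (auto simp: fun_eq_iff)
    moreover have "exec (Dec (x + 1)) (\<sigma>(x + 1 := Suc k, x + 2 := \<sigma> (x + 2) + Suc k, x + 3 := 0)) ?\<sigma>"
      by (rule exec_Dec) (use Suc.prems in \<open>auto simp: fun_eq_iff\<close>)
    ultimately have "exec ?body \<sigma> ?\<sigma>" by (blast intro: exec.Seq)
    moreover have "exec (While (x + 1) ?body) ?\<sigma> (\<sigma>(x + 1 := 0, x + 2 := \<sigma> (x + 2) + triangle (\<sigma> (x + 1))))"
      by (rule exec_eq[OF Suc.hyps(1)]) (use k Suc.prems in \<open>auto simp: fun_eq_iff\<close>)
    ultimately show ?case using k by (auto intro: exec.While_Suc)
  qed
  let ?\<tau> = "\<sigma>(x := 0, x + 1 := \<sigma> x + \<sigma> (x + 1), x + 2 := \<sigma> x, x + 3 := 0)"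
  have "exec (While x (Dec x ;; Inc (x + 1) ;; Inc (x + 2))) (\<sigma>(x + 2 := 0, x + 3 := 0)) ?\<tau>"
    by (rule exec_eq[OF exec_transfer_loop]) (auto simp: fun_eq_iff)
  moreover have "exec (While (x + 1) ?body) ?\<tau>
      (\<sigma>(x := 0, x + 1 := 0, x + 2 := prod_encode (\<sigma> x, \<sigma> (x + 1)), x + 3 := 0))"
    by (rule exec_eq[OF loop]) (auto simp: fun_eq_iff prod_encode_def)
  ultimately show ?thesis
    unfolding Encode_def by (blast intro: exec.Seq exec_Clear)
qed

text \<open>Steps \<open>x\<close> times through the enumeration of pairs underlying \<^const>\<open>prod_decode\<close>.\<close>

definition Decode :: "nat \<Rightarrow> com" where
  "Decode x = Clear (x + 1) ;; Clear (x + 2) ;; Clear (x + 3) ;; Clear (x + 4) ;; While x (Dec x ;;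
     If_pos (x + 2) (x + 3) (x + 4) (Inc (x + 1) ;; Dec (x + 2)) (Move (x + 1) (x + 2) ;; Inc (x + 2)))"

text \<open>The enumeration runs along antidiagonals, and from the end of one it jumps to the start
  of the next. Decoding can thus proceed by counting, without inverting
  \<open>triangle\<close>.\<close>

lemma prod_decode_Suc:
  "prod_decode (Suc k) =
    (case prod_decode k of (m, n) \<Rightarrow> if n \<noteq> 0 then (Suc m, n - 1) else (0, Suc m))"
proof -
  obtain m n where mn: "prod_decode k = (m, n)" by force
  have k: "k = prod_encode (m, n)" by (simp flip: mn)
  have "Suc k = prod_encode (if n \<noteq> 0 then (Suc m, n - 1) else (0, Suc m))"
    by (cases n) (simp_all add: k prod_encode_def)
  then show ?thesis by (simp add: mn)
qed

lemma exec_Decode: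
  "exec (Decode x) \<sigma> (\<sigma>(x := 0, x + 1 := fst (prod_decode (\<sigma> x)), x + 2 := snd (prod_decode (\<sigma> x)), x + 3 := 0, x + 4 := 0))"
proof -
  let ?step = "If_pos (x + 2) (x + 3) (x + 4) (Inc (x + 1) ;; Dec (x + 2)) (Move (x + 1) (x + 2) ;; Inc (x + 2))"
  have step: "exec ?step \<sigma> (\<sigma>(x + 1 := fst (prod_decode (Suc k)), x + 2 := snd (prod_decode (Suc k))))"
    if "(\<sigma> (x + 1), \<sigma> (x + 2)) = prod_decode k" "\<sigma> (x + 3) = 0" "\<sigma> (x + 4) = 0" for \<sigma> k
  proof (rule exec_If_pos)
    have [simp]: "\<sigma>(x + 3 := 0, x + 4 := 0) = \<sigma>"
      using that by (auto simp: fun_eq_iff)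
    let ?\<tau> = "\<sigma>(x + 1 := fst (prod_decode (Suc k)), x + 2 := snd (prod_decode (Suc k)))"
    show "exec (Inc (x + 1) ;; Dec (x + 2)) (\<sigma>(x + 3 := 0, x + 4 := 0)) ?\<tau>" if "\<sigma> (x + 2) \<noteq> 0"
      using that \<open>_ = prod_decode k\<close>[symmetric]
      by (intro exec.Seq[OF exec.Inc] exec_Dec) (auto simp: prod_decode_Suc fun_eq_iff)
    show "exec (Move (x + 1) (x + 2) ;; Inc (x + 2)) (\<sigma>(x + 3 := 0, x + 4 := 0)) ?\<tau>" if "\<sigma> (x + 2) = 0"
      using that \<open>_ = prod_decode k\<close>[symmetric]
      by (intro exec.Seq[OF exec_Move] exec_Inc) (auto simp: prod_decode_Suc fun_eq_iff)
  qed (use that in auto)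
  \<comment> \<open>The code \<open>k\<close> of the pair reached so far is arbitrary, because each
    round of the loop raises it by one.\<close>
  have loop: "exec (While x (Dec x ;; ?step)) \<sigma>
      (\<sigma>(x := 0, x + 1 := fst (prod_decode (k + \<sigma> x)), x + 2 := snd (prod_decode (k + \<sigma> x))))"
    if "(\<sigma> (x + 1), \<sigma> (x + 2)) = prod_decode k" "\<sigma> (x + 3) = 0" "\<sigma> (x + 4) = 0" for \<sigma> k
    using that
  proof (induction "\<sigma> x" arbitrary: \<sigma> k)
    case 0
    then have "\<sigma>(x := 0, x + 1 := fst (prod_decode (k + \<sigma> x)), x + 2 := snd (prod_decode (k + \<sigma> x))) = \<sigma>"
      by (auto simp: fun_eq_iff simp flip: 0(2))
    with 0(1) exec.While_0[of \<sigma> x] show ?case by metis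
  next
    case (Suc n)
    note n = Suc.hyps(2)[symmetric]
    let ?\<sigma> = "\<sigma>(x := n, x + 1 := fst (prod_decode (Suc k)), x + 2 := snd (prod_decode (Suc k)))"
    have "exec (Dec x) \<sigma> (\<sigma>(x := n))"
      using n by (intro exec_Dec) simp
    moreover have "exec ?step (\<sigma>(x := n)) ?\<sigma>"
      by (rule step) (use Suc.prems in auto)
    moreover have "exec (While x (Dec x ;; ?step)) ?\<sigma>
        (\<sigma>(x := 0, x + 1 := fst (prod_decode (k + \<sigma> x)), x + 2 := snd (prod_decode (k + \<sigma> x))))"
      by (rule exec_eq[OF Suc.hyps(1)[where k = "Suc k"]]) (use n Suc.prems in \<open>auto simp: fun_eq_iff\<close>)
    ultimately show ?case using n by (auto intro: exec.While_Suc exec.Seq)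
  qed
  let ?\<tau> = "\<sigma>(x + 1 := 0, x + 2 := 0, x + 3 := 0, x + 4 := 0)"
  have "exec (While x (Dec x ;; ?step)) ?\<tau>
      (\<sigma>(x := 0, x + 1 := fst (prod_decode (\<sigma> x)), x + 2 := snd (prod_decode (\<sigma> x)), x + 3 := 0, x + 4 := 0))"
    by (rule exec_eq[OF loop[where k = 0]])
      (auto simp: fun_eq_iff prod_decode_def prod_decode_aux.simps)
  then show ?thesis
    unfolding Decode_def by (blast intro: exec.Seq exec_Clear)
qed

text \<open>Stack discipline: the variables above \<open>x\<close> are scratch space with arbitrary initial contents.\<close>

definition evaluates :: "nat \<Rightarrow> com \<Rightarrow> (nat \<Rightarrow> nat) \<Rightarrow> bool" where
  "evaluates x c f \<longleftrightarrow>
    (\<forall>\<sigma>. \<exists>\<sigma>'. exec c \<sigma> \<sigma>' \<and> \<sigma>' x = f (\<sigma> x) \<and> (\<forall>y<x. \<sigma>' y = \<sigma> y))"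

lemma evaluatesD:
  assumes "evaluates x c f"
  obtains \<sigma>' where "exec c \<sigma> \<sigma>'" "\<sigma>' x = f (\<sigma> x)" "\<And>y. y < x \<Longrightarrow> \<sigma>' y = \<sigma> y"
  using assms unfolding evaluates_def by blast

lemma evaluates_comp:
  assumes "evaluates x c f" "evaluates x d g"
  shows "evaluates x (d ;; c) (\<lambda>n. f (g n))"
  unfolding evaluates_def
proof
  fix \<sigma> :: store
  obtain \<sigma>1 where 1: "exec d \<sigma> \<sigma>1" "\<sigma>1 x = g (\<sigma> x)" "\<And>y. y < x \<Longrightarrow> \<sigma>1 y = \<sigma> y"
    using assms(2) by (rule evaluatesD[where \<sigma> = \<sigma>]) blast
  obtain \<sigma>2 where 2: "exec c \<sigma>1 \<sigma>2" "\<sigma>2 x = f (\<sigma>1 x)" "\<And>y. y < x \<Longrightarrow> \<sigma>2 y = \<sigma>1 y"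
    using assms(1) by (rule evaluatesD[where \<sigma> = \<sigma>1]) blast
  show "\<exists>\<sigma>'. exec (d ;; c) \<sigma> \<sigma>' \<and> \<sigma>' x = f (g (\<sigma> x)) \<and> (\<forall>y<x. \<sigma>' y = \<sigma> y)"
    using 1 2 by (intro exI[of _ \<sigma>2]) (auto intro: exec.Seq)
qed

text \<open>Raising the base protects what is still needed: \<open>c\<close> runs at
  \<open>x + 1\<close> and preserves the argument in \<open>x\<close>, and \<open>d\<close> runs at
  \<open>x + 2\<close> and also preserves the value of \<open>f\<close>.
  \<open>Encode (x + 1)\<close> then delivers its result in \<open>x + 3\<close>.\<close>

lemma evaluates_pair:
  assumes f: "evaluates (x + 1) c f" and g: "evaluates (x + 2) d g"
  shows "evaluates x (Copy x (x + 1) (x + 2) ;; c ;; Copy x (x + 2) (x + 3) ;; d ;;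
    Encode (x + 1) ;; Move (x + 3) x) (\<lambda>n. prod_encode (f n, g n))"
  unfolding evaluates_def
proof
  fix \<sigma> :: store
  note 1 = exec_Copy[of x "x + 1" "x + 2" \<sigma>]
  obtain \<sigma>2 where 2: "exec c (\<sigma>(x + 1 := \<sigma> x, x + 2 := 0)) \<sigma>2" "\<sigma>2 (x + 1) = f (\<sigma> x)"
    "\<And>y. y < x + 1 \<Longrightarrow> \<sigma>2 y = \<sigma> y"
    using f by (rule evaluatesD[where \<sigma> = "\<sigma>(x + 1 := \<sigma> x, x + 2 := 0)"]) auto
  note 3 = exec_Copy[of x "x + 2" "x + 3" \<sigma>2]
  obtain \<sigma>4 where 4: "exec d (\<sigma>2(x + 2 := \<sigma>2 x, x + 3 := 0)) \<sigma>4" "\<sigma>4 (x + 2) = g (\<sigma> x)"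
    "\<And>y. y < x + 2 \<Longrightarrow> \<sigma>4 y = \<sigma>2 y"
    using g 2(3)[of x] by (rule_tac evaluatesD[where \<sigma> = "\<sigma>2(x + 2 := \<sigma>2 x, x + 3 := 0)"]) auto
  note 5 = exec_Encode[of "x + 1" \<sigma>4]
  note 6 = exec_Move[of "x + 3" x "\<sigma>4(x + 1 := 0, x + 1 + 1 := 0,
    x + 1 + 2 := prod_encode (\<sigma>4 (x + 1), \<sigma>4 (x + 1 + 1)), x + 1 + 3 := 0)"]
  show "\<exists>\<sigma>'. exec (Copy x (x + 1) (x + 2) ;; c ;; Copy x (x + 2) (x + 3) ;; d ;;
    Encode (x + 1) ;; Move (x + 3) x) \<sigma> \<sigma>' \<and> \<sigma>' x = prod_encode (f (\<sigma> x), g (\<sigma> x)) \<and> (\<forall>y<x. \<sigma>' y = \<sigma> y)"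
    by (intro exI conjI exec.Seq, rule 1, simp, rule 2, rule 3, simp, rule 4, rule 5, rule 6)
      (use 2 4 in \<open>auto simp: numeral_eq_Suc\<close>)
qed

lemma evaluates_iter:
  assumes f: "evaluates (x + 1) c f"
  shows "evaluates x (Decode x ;; Move (x + 2) x ;; While x (Dec x ;; c) ;; Move (x + 1) x)
    (\<lambda>n. (f ^^ snd (prod_decode n)) (fst (prod_decode n)))"
  unfolding evaluates_def
proof
  fix \<sigma> :: store
  have loop: "\<exists>\<sigma>'. exec (While x (Dec x ;; c)) \<sigma> \<sigma>' \<and> \<sigma>' (x + 1) = (f ^^ \<sigma> x) (\<sigma> (x + 1)) \<and> (\<forall>y<x. \<sigma>' y = \<sigma> y)" for \<sigma>
  proof (induction "\<sigma> x" arbitrary: \<sigma>)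
    case 0
    then show ?case by (intro exI[of _ \<sigma>]) (auto intro: exec.While_0)
  next
    case (Suc n)
    note n = Suc.hyps(2)[symmetric]
    obtain \<sigma>1 where 1: "exec c (\<sigma>(x := n)) \<sigma>1" "\<sigma>1 (x + 1) = f (\<sigma> (x + 1))" "\<And>y. y < x + 1 \<Longrightarrow> \<sigma>1 y = (\<sigma>(x := n)) y"
      using f by (rule evaluatesD[where \<sigma> = "\<sigma>(x := n)"]) auto
    have "n = \<sigma>1 x" using 1(3)[of x] by simp
    from Suc.hyps(1)[of \<sigma>1, OF this] obtain \<sigma>2 where 2: "exec (While x (Dec x ;; c)) \<sigma>1 \<sigma>2"
      "\<sigma>2 (x + 1) = (f ^^ n) (\<sigma>1 (x + 1))" "\<forall>y<x. \<sigma>2 y = \<sigma>1 y"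
      using 1(3)[of x] by auto
    have "exec (Dec x) \<sigma> (\<sigma>(x := n))" using n by (intro exec_Dec) simp
    then have "exec (While x (Dec x ;; c)) \<sigma> \<sigma>2"
      using exec.While_Suc[OF _ exec.Seq 2(1)] 1(1) n by simp
    with 1 2 n show ?case
      by (intro exI[of _ \<sigma>2]) (simp add: funpow_swap1)
  qed
  let ?n = "\<sigma> x"
  let ?\<tau> = "\<sigma>(x := 0, x + 1 := fst (prod_decode ?n), x + 2 := snd (prod_decode ?n), x + 3 := 0, x + 4 := 0)"
  note 1 = exec_Decode[of x \<sigma>]
  note 2 = exec_Move[of "x + 2" x ?\<tau>]
  obtain \<sigma>3 where 3: "exec (While x (Dec x ;; c)) (?\<tau>(x + 2 := 0, x := ?\<tau> (x + 2))) \<sigma>3"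
    "\<sigma>3 (x + 1) = (f ^^ snd (prod_decode ?n)) (fst (prod_decode ?n))" "\<And>y. y < x \<Longrightarrow> \<sigma>3 y = \<sigma> y"
    using loop[of "?\<tau>(x + 2 := 0, x := ?\<tau> (x + 2))"] by auto
  note 4 = exec_Move[of "x + 1" x \<sigma>3]
  show "\<exists>\<sigma>'. exec (Decode x ;; Move (x + 2) x ;; While x (Dec x ;; c) ;; Move (x + 1) x) \<sigma> \<sigma>' \<and>
      \<sigma>' x = (f ^^ snd (prod_decode ?n)) (fst (prod_decode ?n)) \<and> (\<forall>y<x. \<sigma>' y = \<sigma> y)"
    by (intro exI conjI exec.Seq, rule 1, rule 2, simp, rule 3, rule 4) (use 3 in auto)
qed

text \<open>Layout: argument in \<open>x\<close>, candidate in \<open>x + 1\<close>, copies of both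
  in \<open>x + 2\<close> and \<open>x + 3\<close>. \<open>Encode (x + 2)\<close> leaves the pair in
  \<open>x + 4\<close>, which is therefore the base of \<open>c\<close>. The distance of the
  candidate to the least zero bounds the number of rounds.\<close>

lemma evaluates_least:
  assumes f: "evaluates (x + 4) c f" and ex: "\<And>n. \<exists>k. f (prod_encode (n, k)) = 0"
  defines "test \<equiv> Copy x (x + 2) (x + 4) ;; Copy (x + 1) (x + 3) (x + 4) ;; Encode (x + 2) ;; c"
  shows "evaluates x (Clear (x + 1) ;; test ;; While (x + 4) (Inc (x + 1) ;; test) ;; Move (x + 1) x)
    (\<lambda>n. LEAST k. f (prod_encode (n, k)) = 0)"
  unfolding evaluates_def
proof
  fix \<sigma> :: store
  define m where "m = (LEAST k. f (prod_encode (\<sigma> x, k)) = 0)"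
  have m: "f (prod_encode (\<sigma> x, m)) = 0" "k < m \<Longrightarrow> f (prod_encode (\<sigma> x, k)) \<noteq> 0" for k
    using LeastI_ex[OF ex] not_less_Least unfolding m_def by blast+
  have test: "\<exists>\<tau>'. exec test \<tau> \<tau>' \<and> \<tau>' (x + 4) = f (prod_encode (\<tau> x, \<tau> (x + 1))) \<and> (\<forall>y\<le>x + 1. \<tau>' y = \<tau> y)" for \<tau>
  proof -
    note 1 = exec_Copy[of x "x + 2" "x + 4" \<tau>]
    note 2 = exec_Copy[of "x + 1" "x + 3" "x + 4" "\<tau>(x + 2 := \<tau> x, x + 4 := 0)"]
    let ?\<tau> = "\<tau>(x + 2 := \<tau> x, x + 3 := \<tau> (x + 1), x + 4 := 0)"
    have 3: "exec (Encode (x + 2)) (\<tau>(x + 2 := \<tau> x, x + 4 := 0, x + 3 := (\<tau>(x + 2 := \<tau> x, x + 4 := 0)) (x + 1), x + 4 := 0))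
       (\<tau>(x + 2 := 0, x + 3 := 0, x + 4 := prod_encode (\<tau> x, \<tau> (x + 1)), x + 5 := 0))"
      by (rule exec_eq[OF exec_Encode]) (auto simp: fun_eq_iff numeral_eq_Suc)
    obtain \<tau>' where 4: "exec c (\<tau>(x + 2 := 0, x + 3 := 0, x + 4 := prod_encode (\<tau> x, \<tau> (x + 1)), x + 5 := 0)) \<tau>'"
      "\<tau>' (x + 4) = f (prod_encode (\<tau> x, \<tau> (x + 1)))"
      "\<And>y. y < x + 4 \<Longrightarrow> \<tau>' y = (\<tau>(x + 2 := 0, x + 3 := 0, x + 4 := prod_encode (\<tau> x, \<tau> (x + 1)), x + 5 := 0)) y"
      using f by (rule evaluatesD[where \<sigma> = "\<tau>(x + 2 := 0, x + 3 := 0, x + 4 := prod_encode (\<tau> x, \<tau> (x + 1)), x + 5 := 0)"]) auto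
    show ?thesis unfolding test_def
      by (intro exI conjI exec.Seq, rule 1, simp, rule 2, simp, rule 3, rule 4) (use 4 in auto)
  qed
  have loop: "\<exists>\<tau>'. exec (While (x + 4) (Inc (x + 1) ;; test)) \<tau> \<tau>' \<and> \<tau>' (x + 1) = m \<and> (\<forall>y\<le>x. \<tau>' y = \<tau> y)"
    if "\<tau> x = \<sigma> x" "\<tau> (x + 1) \<le> m" "\<tau> (x + 4) = f (prod_encode (\<sigma> x, \<tau> (x + 1)))" for \<tau>
    using that
  proof (induction "m - \<tau> (x + 1)" arbitrary: \<tau>)
    case 0
    then have "\<tau> (x + 1) = m" by simp
    with 0 m(1) show ?case by (intro exI[of _ \<tau>]) (auto intro: exec.While_0)
  next
    case (Suc d)
    let ?\<tau> = "\<tau>(x + 1 := Suc (\<tau> (x + 1)))"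
    obtain \<tau>1 where 1: "exec test ?\<tau> \<tau>1" "\<tau>1 (x + 4) = f (prod_encode (\<sigma> x, Suc (\<tau> (x + 1))))" "\<forall>y\<le>x + 1. \<tau>1 y = ?\<tau> y"
      using test[of ?\<tau>] Suc.prems by auto
    have "d = m - \<tau>1 (x + 1)" "\<tau>1 x = \<sigma> x" "\<tau>1 (x + 1) \<le> m" "\<tau>1 (x + 4) = f (prod_encode (\<sigma> x, \<tau>1 (x + 1)))"
      using 1 Suc.hyps(2) Suc.prems by auto
    from Suc.hyps(1)[of \<tau>1, OF this] obtain \<tau>2 where 2: "exec (While (x + 4) (Inc (x + 1) ;; test)) \<tau>1 \<tau>2"
      "\<tau>2 (x + 1) = m" "\<forall>y\<le>x. \<tau>2 y = \<tau>1 y"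
      by blast
    have "\<tau> (x + 4) \<noteq> 0" using Suc.hyps(2) Suc.prems m(2) by simp
    then have "exec (While (x + 4) (Inc (x + 1) ;; test)) \<tau> \<tau>2"
      using exec.While_Suc[OF _ exec.Seq[OF exec.Inc 1(1)] 2(1)] by simp
    then show ?case using 1 2 by (intro exI[of _ \<tau>2]) simp
  qed
  note 1 = exec_Clear[of "x + 1" \<sigma>]
  obtain \<sigma>2 where 2: "exec test (\<sigma>(x + 1 := 0)) \<sigma>2" "\<sigma>2 (x + 4) = f (prod_encode (\<sigma> x, 0))" "\<forall>y\<le>x + 1. \<sigma>2 y = (\<sigma>(x + 1 := 0)) y"
    using test[of "\<sigma>(x + 1 := 0)"] by auto
  obtain \<sigma>3 where 3: "exec (While (x + 4) (Inc (x + 1) ;; test)) \<sigma>2 \<sigma>3" "\<sigma>3 (x + 1) = m" "\<forall>y\<le>x. \<sigma>3 y = \<sigma>2 y"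
    using loop[of \<sigma>2] 2 by auto
  note 4 = exec_Move[of "x + 1" x \<sigma>3]
  show "\<exists>\<sigma>'. exec (Clear (x + 1) ;; test ;; While (x + 4) (Inc (x + 1) ;; test) ;; Move (x + 1) x) \<sigma> \<sigma>' \<and>
      \<sigma>' x = (LEAST k. f (prod_encode (\<sigma> x, k)) = 0) \<and> (\<forall>y<x. \<sigma>' y = \<sigma> y)"
    unfolding m_def[symmetric]
    by (intro exI conjI exec.Seq, rule 1, rule 2, rule 3, rule 4) (use 2 3 in auto)
qed

text \<open>The base \<open>x\<close> has to be arbitrary in the induction, since subprograms are
  called at higher bases.\<close>

lemma recf_imp_evaluates:
  assumes "recf f"
  shows "\<exists>c. evaluates x c f"
  using assms
proof (induction arbitrary: x)
  case zero
  have "evaluates x (Clear x) (\<lambda>_. 0)"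
    unfolding evaluates_def using exec_Clear[of x] by fastforce
  then show ?case ..
next
  case Suc
  have "evaluates x (Inc x) Suc"
    unfolding evaluates_def using exec.Inc[of x] by fastforce
  then show ?case ..
next
  case fst
  have "evaluates x (Decode x ;; Move (x + 1) x) (\<lambda>n. fst (prod_decode n))"
    unfolding evaluates_def
    by (intro allI exI conjI exec.Seq, rule exec_Decode, rule exec_Move) auto
  then show ?case ..
next
  case snd
  have "evaluates x (Decode x ;; Move (x + 2) x) (\<lambda>n. snd (prod_decode n))"
    unfolding evaluates_def
    by (intro allI exI conjI exec.Seq, rule exec_Decode, rule exec_Move) auto
  then show ?case ..
next
  case (comp f g)
  then show ?case using evaluates_comp by blast
next
  case (pair f g)
  then show ?case using evaluates_pair by blast
next
  case (iter f)
  then show ?case using evaluates_iter by blast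
next
  case (least f)
  then show ?case using evaluates_least by blast
qed

section \<open>Turing machines\<close>

lemma tm_run_0: "tm_run M p 0 = tm_init M p"
  by (simp add: tm_run_def)

lemma tm_run_Suc: "tm_run M p (Suc t) = tm_step M (tm_run M p t)"
  by (simp add: tm_run_def)

lemma tm_run_add: "tm_run M p (t + k) = (tm_step M ^^ k) (tm_run M p t)"
  by (induction k) (simp_all add: tm_run_Suc)

lemma tm_step_halted: "fst c = 1 \<Longrightarrow> tm_step M c = c"
  by (cases c) simp

lemma tm_run_halted:
  assumes "fst (tm_run M p t) = 1" "t \<le> t'"
  shows "tm_run M p t' = tm_run M p t"
  using assms(2) by (induction rule: dec_induct) (simp_all add: tm_run_Suc tm_step_halted assms(1))

lemma tm_run_stuck:
  assumes "tm_step M (tm_run M p t) = tm_run M p t" "fst (tm_run M p t) \<noteq> 1"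
  shows "p \<notin> tm_dom M"
proof
  assume "p \<in> tm_dom M"
  then obtain t' where t': "fst (tm_run M p t') = 1" by (auto simp: tm_dom_def)
  have "tm_run M p (t + k) = tm_run M p t" for k
    by (induction k) (simp_all add: tm_run_Suc assms(1))
  from this[of t'] tm_run_halted[OF t', of "t + t'"] t' assms(2) show False by simp
qed

lemma tm_output_halted:
  assumes "fst (tm_run M p t) = 1"
  shows "tm_output M p = Some (read_tape (last (snd (tm_run M p t))))"
proof -
  let ?l = "LEAST t. fst (tm_run M p t) = 1"
  have "tm_run M p t = tm_run M p ?l"
    using LeastI[of "\<lambda>t. fst (tm_run M p t) = 1", OF assms] Least_le[of "\<lambda>t. fst (tm_run M p t) = 1", OF assms]
    by (intro tm_run_halted)
  moreover have "p \<in> tm_dom M" using assms by (auto simp: tm_dom_def)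
  ultimately show ?thesis by (simp add: tm_output_def)
qed

lemma tm_step_set:
  assumes "T \<in> set (snd (tm_step M c))"
  shows "T \<in> set (snd c) \<or> (\<exists>a T'. T' \<in> set (snd c) \<and> T = update_tape a T')"
proof -
  obtain q ts where c: "c = (q, ts)" by force
  obtain q' as where d: "delta M q (map (\<lambda>(c, i). c i) ts) = (q', as)" by force
  have "\<exists>a T'. T' \<in> set ts \<and> T = update_tape a T'" if "T \<in> set (map2 update_tape as ts)"
  proof -
    from that obtain a T' where "(a, T') \<in> set (zip as ts)" "T = update_tape a T'" by auto
    then show ?thesis by (blast dest: set_zip_rightD)
  qed
  then show ?thesis using assms by (auto simp: c d split: if_splits)
qed

text \<open>A head moves at most one cell per step and only the scanned cell is written. Hence run
  time bounds the length of the output.\<close>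

lemma tape_growth:
  assumes "T \<in> set (snd (tm_run M p t))"
  shows "snd T \<le> int t \<and> (\<forall>i \<ge> int (length p + t). fst T i = 0)"
  using assms
proof (induction t arbitrary: T)
  case 0
  then show ?case by (auto simp: tm_run_0 tm_init_def input_tape_def blank_tape_def)
next
  case (Suc t)
  from tm_step_set[OF Suc.prems[unfolded tm_run_Suc]] show ?case
  proof
    assume "T \<in> set (snd (tm_run M p t))"
    from Suc.IH[OF this] show ?thesis by auto
  next
    assume "\<exists>a T'. T' \<in> set (snd (tm_run M p t)) \<and> T = update_tape a T'"
    then obtain s d c i where T: "(c, i) \<in> set (snd (tm_run M p t))" "T = update_tape (s, d) (c, i)"
      by auto
    from Suc.IH[OF T(1)] show ?thesis by (cases d) (auto simp: T(2))
  qed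
qed

definition wf_config :: "tm \<Rightarrow> config \<Rightarrow> bool" where
  "wf_config M c \<longleftrightarrow> fst c < nstates M \<and> length (snd c) = ntapes M \<and>
     (\<forall>T\<in>set (snd c). \<forall>i. fst T i < nsyms M)"

lemma wf_config_init: "wf_tm M \<Longrightarrow> wf_config M (tm_init M p)"
  by (auto simp: wf_tm_def wf_config_def tm_init_def input_tape_def blank_tape_def)

lemma wf_config_step:
  assumes "wf_tm M" "wf_config M c"
  shows "wf_config M (tm_step M c)"
proof (cases "fst c = 1")
  case True
  then show ?thesis using assms(2) by (simp add: tm_step_halted)
next
  case False
  obtain q ts where c: "c = (q, ts)" by force
  let ?ss = "map (\<lambda>(c, i). c i) ts"
  obtain q' as where d: "delta M q ?ss = (q', as)" by force
  have "length ?ss = ntapes M" "\<forall>s\<in>set ?ss. s < nsyms M" "q < nstates M" "q \<noteq> 1"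
    using assms(2) False by (auto simp: wf_config_def c)
  then have *: "q' < nstates M" "length as = ntapes M" "\<forall>(s, d)\<in>set as. s < nsyms M"
    using assms(1) d unfolding wf_tm_def by (metis fst_conv snd_conv)+
  have "fst T i < nsyms M" if "T \<in> set (map2 update_tape as ts)" for T i
  proof -
    from that obtain a b f j where ab: "((a, b), (f, j)) \<in> set (zip as ts)" "T = update_tape (a, b) (f, j)"
      by auto
    have "a < nsyms M" "f i < nsyms M"
      using *(3) set_zip_leftD[OF ab(1)] set_zip_rightD[OF ab(1)] assms(2) by (auto simp: wf_config_def c)
    then show ?thesis by (simp add: ab(2))
  qed
  with * show ?thesis using False assms(2) by (simp add: c d wf_config_def)
qed

lemma wf_config_run: "wf_tm M \<Longrightarrow> wf_config M (tm_run M p t)"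
  by (induction t) (simp_all add: tm_run_0 tm_run_Suc wf_config_init wf_config_step)

lemma last_in_set_tm_run: "wf_tm M \<Longrightarrow> last (snd (tm_run M p t)) \<in> set (snd (tm_run M p t))"
  using wf_config_run[of M p t] by (auto simp: wf_config_def wf_tm_def intro!: last_in_set)

lemma length_tm_output_le:
  assumes "wf_tm M" "fst (tm_run M p t) = 1"
  obtains out where "tm_output M p = Some out" "length out \<le> length p + t"
proof -
  let ?T = "last (snd (tm_run M p t))"
  have "fst ?T (int (length p + t)) = 0"
    using tape_growth[OF last_in_set_tm_run[OF assms(1)], of p t] by simp
  then have "(LEAST n. fst ?T (int n) \<notin> {1, 2}) \<le> length p + t"
    by (intro Least_le) simp
  then show thesis
    using that tm_output_halted[OF assms(2)] by (simp add: read_tape_def)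
qed

lemma length_tm_output_ge:
  assumes "wf_tm M" "fst (tm_run M p t) = 1"
    and bits: "\<And>i. i < k \<Longrightarrow> fst (last (snd (tm_run M p t))) (int i) \<in> {1, 2}"
  obtains out where "tm_output M p = Some out" "length out \<ge> k"
proof -
  let ?T = "last (snd (tm_run M p t))"
  \<comment> \<open>Some cell has to hold no bit, or else the \<open>LEAST\<close> in
    \<open>read_tape\<close> would be unspecified.\<close>
  have "fst ?T (int (length p + t)) = 0"
    using tape_growth[OF last_in_set_tm_run[OF assms(1)], of p t] by simp
  then have "fst ?T (int (length p + t)) \<notin> {1, 2}" by simp
  from LeastI[of "\<lambda>n. fst ?T (int n) \<notin> {1, 2}", OF this]
  have "k \<le> (LEAST n. fst ?T (int n) \<notin> {1, 2})"
    using bits by (meson not_less)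
  then show thesis
    using that tm_output_halted[OF assms(2)] by (simp add: read_tape_def)
qed

section \<open>Compilation of counter programs to jump code\<close>

datatype instr = INC nat | DEC nat | JZ nat nat | JMP nat

fun instr_step :: "instr \<Rightarrow> nat \<times> store \<Rightarrow> nat \<times> store" where
  "instr_step (INC x) (pc, \<sigma>) = (Suc pc, \<sigma>(x := Suc (\<sigma> x)))"
| "instr_step (DEC x) (pc, \<sigma>) = (Suc pc, \<sigma>(x := \<sigma> x - 1))"
| "instr_step (JZ x l) (pc, \<sigma>) = (if \<sigma> x = 0 then l else Suc pc, \<sigma>)"
| "instr_step (JMP l) (pc, \<sigma>) = (l, \<sigma>)"

definition code_step :: "instr list \<Rightarrow> nat \<times> store \<Rightarrow> nat \<times> store" where
  "code_step P s = (if fst s < length P then instr_step (P ! fst s) s else s)"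

text \<open>Jumps are absolute, so \<open>a\<close> is the address of the first instruction. The 2
  in the exit address accounts for the \<open>JZ\<close> and the \<open>JMP\<close> around the
  body.\<close>

fun compile :: "nat \<Rightarrow> com \<Rightarrow> instr list" where
  "compile a (Inc x) = [INC x]"
| "compile a (Dec x) = [DEC x]"
| "compile a (c ;; d) = compile a c @ compile (a + length (compile a c)) d"
| "compile a (While x c) = JZ x (a + length (compile (Suc a) c) + 2) # compile (Suc a) c @ [JMP a]"

text \<open>The surrounding code \<open>pre\<close> and \<open>post\<close> is arbitrary so that the
  induction hypotheses apply to subcommands inside the same program \<open>P\<close>.\<close>

lemma compile_correct:
  assumes "exec c \<sigma> \<sigma>'" "P = pre @ compile (length pre) c @ post"
  shows "\<exists>k. (code_step P ^^ k) (length pre, \<sigma>) = (length pre + length (compile (length pre) c), \<sigma>')"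
  using assms
proof (induction arbitrary: pre post rule: exec.induct)
  case (Inc x \<sigma>)
  then show ?case by (intro exI[of _ 1]) (simp add: code_step_def nth_append fun_eq_iff)
next
  case (Dec x \<sigma>)
  then show ?case by (intro exI[of _ 1]) (simp add: code_step_def nth_append fun_eq_iff)
next
  case (Seq c \<sigma> \<sigma>' d \<sigma>'')
  let ?C = "compile (length pre) c"
  obtain k1 where k1: "(code_step P ^^ k1) (length pre, \<sigma>) = (length pre + length ?C, \<sigma>')"
    using Seq.IH(1)[of pre] Seq.prems by fastforce
  obtain k2 where k2: "(code_step P ^^ k2) (length pre + length ?C, \<sigma>') =
      (length pre + length (compile (length pre) (c ;; d)), \<sigma>'')"
    using Seq.IH(2)[of "pre @ ?C" post] Seq.prems by (auto simp: add.assoc)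
  show ?case
    by (rule exI[of _ "k2 + k1"]) (simp only: funpow_add o_apply k1 k2)
next
  case (While_0 \<sigma> x c)
  then show ?case by (intro exI[of _ 1]) (simp add: code_step_def nth_append fun_eq_iff)
next
  case (While_Suc \<sigma> x c \<sigma>' \<sigma>'')
  let ?C = "compile (Suc (length pre)) c"
  let ?J = "JZ x (length pre + length ?C + 2)"
  have P: "P = (pre @ [?J]) @ compile (length (pre @ [?J])) c @ (JMP (length pre) # post)"
    using While_Suc.prems by simp
  have k0: "(code_step P ^^ 1) (length pre, \<sigma>) = (Suc (length pre), \<sigma>)"
    using While_Suc.prems While_Suc.hyps(1) by (simp add: code_step_def nth_append)
  obtain k1 where k1: "(code_step P ^^ k1) (Suc (length pre), \<sigma>) = (Suc (length pre + length ?C), \<sigma>')"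
    using While_Suc.IH(1)[OF P] by auto
  have k2: "(code_step P ^^ 1) (Suc (length pre + length ?C), \<sigma>') = (length pre, \<sigma>')"
    using While_Suc.prems by (simp add: code_step_def nth_append)
  obtain k3 where k3: "(code_step P ^^ k3) (length pre, \<sigma>') =
      (length pre + length (compile (length pre) (While x c)), \<sigma>'')"
    using While_Suc.IH(2)[OF While_Suc.prems] by auto
  show ?case
    by (rule exI[of _ "k3 + (1 + (k1 + 1))"]) (simp only: funpow_add o_apply k0 k1 k2 k3)
qed

fun instr_var :: "instr \<Rightarrow> nat" where
  "instr_var (INC x) = x"
| "instr_var (DEC x) = x"
| "instr_var (JZ x l) = x"
| "instr_var (JMP l) = 0"

text \<open>The counter machine with program \<open>P\<close> and \<open>V\<close> variables, preceded by a routine that accepts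
  only the inputs \<open>1\<^sup>m0\<close> and puts \<open>m\<close> into variable 0. Tape 0 holds the input and tape \<open>V - x\<close>
  the variable \<open>x\<close>, in the form of the head position; the symbol 1 marks cell 0. Incrementing
  leaves the symbol 2 behind, so that variable 0 can be read off as the length of the output.\<close>

definition state_of_pc :: "instr list \<Rightarrow> nat \<Rightarrow> nat" where
  "state_of_pc P pc = (if pc < length P then pc + 4 else 1)"

fun instr_action :: "instr \<Rightarrow> nat \<Rightarrow> nat \<Rightarrow> nat \<Rightarrow> nat \<times> move" where
  "instr_action (INC x) V j s = (if j = V - x then (if s = 1 then 1 else 2, MoveRight) else (s, Stay))"
| "instr_action (DEC x) V j s = (s, if j = V - x \<and> s \<noteq> 1 then MoveLeft else Stay)"
| "instr_action _ V j s = (s, Stay)"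

fun instr_target :: "instr \<Rightarrow> nat \<Rightarrow> nat \<Rightarrow> nat list \<Rightarrow> nat" where
  "instr_target (JZ x l) V pc ss = (if ss ! (V - x) = 1 then l else Suc pc)"
| "instr_target (JMP l) V pc ss = l"
| "instr_target _ V pc ss = Suc pc"

text \<open>State 0 writes the markers, state 2 counts the leading bits \<open>True\<close> into
  variable 0, state 3 checks that the input ends after the first \<open>False\<close>, and state pc
  + 4 executes the instruction at pc; 1 is reserved for halting.\<close>

definition next_state :: "instr list \<Rightarrow> nat \<Rightarrow> nat \<Rightarrow> nat list \<Rightarrow> nat" where
  "next_state P V q ss =
    (if q = 0 then 2
     else if q = 2 then (if ss ! 0 = 1 then 3 else 2)
     else if q = 3 then (if ss ! 0 = 0 then state_of_pc P 0 else 3)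
     else state_of_pc P (instr_target (P ! (q - 4)) V (q - 4) ss))"

definition tape_action :: "instr list \<Rightarrow> nat \<Rightarrow> nat \<Rightarrow> nat \<Rightarrow> nat \<Rightarrow> nat \<Rightarrow> nat \<times> move" where
  "tape_action P V q s0 j s =
    (if q = 0 then (if j = 0 then s else 1, Stay)
     else if q = 2 then
       (if j = 0 then (s, if s0 = 0 then Stay else MoveRight)
        else if s0 = 2 then instr_action (INC 0) V j s else (s, Stay))
     else if q = 3 then (s, Stay)
     else instr_action (P ! (q - 4)) V j s)"

definition counter_tm :: "instr list \<Rightarrow> nat \<Rightarrow> tm" where
  "counter_tm P V = \<lparr>ntapes = Suc V, nstates = length P + 4, nsyms = 3,
     delta = \<lambda>q ss. (next_state P V q ss, map (\<lambda>j. tape_action P V q (ss ! 0) j (ss ! j)) [0..<Suc V])\<rparr>"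

section \<open>Correctness of the counter machine\<close>

lemma fst_instr_action: "s < 3 \<Longrightarrow> fst (instr_action i V j s) < 3"
  by (cases i) auto

lemma fst_tape_action: "s < 3 \<Longrightarrow> fst (tape_action P V q s0 j s) < 3"
  using fst_instr_action[of s] by (auto simp: tape_action_def simp del: instr_action.simps)

lemma wf_counter_tm: "wf_tm (counter_tm P V)"
proof -
  have "next_state P V q ss < length P + 4" for q ss
    by (auto simp: next_state_def state_of_pc_def)
  then show ?thesis
    unfolding wf_tm_def counter_tm_def
    by (simp add: case_prod_beta fst_tape_action del: upt_Suc)
qed

abbreviation scanned :: "tape \<Rightarrow> nat" where
  "scanned T \<equiv> fst T (snd T)"

lemma counter_tm_step:
  assumes "q \<noteq> 1" "length ts = Suc V" "tm_step (counter_tm P V) (q, ts) = (q', ts')"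
  shows "q' = next_state P V q (map scanned ts)" "length ts' = Suc V"
    "j \<le> V \<Longrightarrow> ts' ! j = update_tape (tape_action P V q (scanned (ts ! 0)) j (scanned (ts ! j))) (ts ! j)"
proof -
  have s: "(\<lambda>(c, i). c i) = scanned" by auto
  show "q' = next_state P V q (map scanned ts)" "length ts' = Suc V"
    "j \<le> V \<Longrightarrow> ts' ! j = update_tape (tape_action P V q (scanned (ts ! 0)) j (scanned (ts ! j))) (ts ! j)"
    using assms by (auto simp: counter_tm_def s simp del: upt_Suc)
qed

lemma update_tape_scanned: "scanned T = s \<Longrightarrow> update_tape (s, Stay) T = T"
  by (cases T) auto

text \<open>From the head onwards only the marker is excluded: decrements leave old symbols 2
  behind. The output can therefore be longer than the value of the variable, and only a lower bound
  on its length is claimed.\<close>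

definition counter_tape :: "nat \<Rightarrow> tape \<Rightarrow> bool" where
  "counter_tape v T \<longleftrightarrow> snd T = int v \<and> fst T 0 = 1 \<and> (\<forall>i>0. fst T i \<noteq> 1) \<and>
     (\<forall>i. 0 < i \<and> i < int v \<longrightarrow> fst T i = 2)"

lemma scanned_counter_tape: "counter_tape v T \<Longrightarrow> scanned T = 1 \<longleftrightarrow> v = 0"
  by (cases "v = 0") (auto simp: counter_tape_def)

lemma counter_tape_inc:
  "counter_tape v T \<Longrightarrow> counter_tape (Suc v) (update_tape (if scanned T = 1 then 1 else 2, MoveRight) T)"
  by (cases T; cases "v = 0") (auto simp: counter_tape_def)

lemma counter_tape_dec:
  "counter_tape v T \<Longrightarrow>
    counter_tape (v - 1) (update_tape (scanned T, if scanned T \<noteq> 1 then MoveLeft else Stay) T)"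
  by (cases T; cases "v = 0") (auto simp: counter_tape_def of_nat_diff)

definition init_store :: "nat \<Rightarrow> store" where
  "init_store m x = (if x = 0 then m else 0)"

definition counter_tapes :: "nat \<Rightarrow> store \<Rightarrow> tape list \<Rightarrow> bool" where
  "counter_tapes V \<sigma> ts \<longleftrightarrow> length ts = Suc V \<and> (\<forall>x<V. counter_tape (\<sigma> x) (ts ! (V - x)))"

text \<open>The two systems run in lockstep: with one tape per variable, each instruction is a
  single machine step, and a zero test is the question whether the marker is scanned.\<close>

lemma counter_tm_simulates_step:
  assumes "\<forall>i\<in>set P. instr_var i < V" "counter_tapes V \<sigma> ts" "code_step P (pc, \<sigma>) = (pc', \<sigma>')"
  shows "\<exists>ts'. tm_step (counter_tm P V) (state_of_pc P pc, ts) = (state_of_pc P pc', ts') \<and> counter_tapes V \<sigma>' ts'"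
proof (cases "pc < length P")
  case False
  then show ?thesis using assms by (auto simp: code_step_def state_of_pc_def)
next
  case True
  then have q: "state_of_pc P pc = pc + 4" by (simp add: state_of_pc_def)
  obtain q' ts' where st: "tm_step (counter_tm P V) (state_of_pc P pc, ts) = (q', ts')" by force
  have len: "length ts = Suc V" using assms(2) by (simp add: counter_tapes_def)
  note step = counter_tm_step[OF _ len st]
  have i: "instr_var (P ! pc) < V" "instr_step (P ! pc) (pc, \<sigma>) = (pc', \<sigma>')"
    using assms(1,3) True by (auto simp: code_step_def)
  have q': "q' = state_of_pc P (instr_target (P ! pc) V pc (map scanned ts))"
    using step(1) by (simp add: q next_state_def)
  have ts': "ts' ! j = update_tape (instr_action (P ! pc) V j (scanned (ts ! j))) (ts ! j)" if "j \<le> V" for j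
    using step(3)[OF _ that] by (simp add: q tape_action_def)
  have len': "length ts' = Suc V" using step(2) by (simp add: q)
  have tapes: "counter_tape (\<sigma> x) (ts ! (V - x))" if "x < V" for x
    using assms(2) that by (simp add: counter_tapes_def)
  have eq: "V - x = V - y \<longleftrightarrow> x = y" if "x < V" "y < V" for x y
    using that by auto
  have "instr_target (P ! pc) V pc (map scanned ts) = pc'"
    using i scanned_counter_tape[OF tapes] len by (cases "P ! pc") auto
  moreover have "counter_tape (\<sigma>' x) (ts' ! (V - x))" if "x < V" for x
  proof (cases "P ! pc")
    case (INC y)
    then show ?thesis using i that counter_tape_inc[OF tapes[OF that]] tapes[OF that]
      by (auto simp: ts' eq update_tape_scanned)
  next
    case (DEC y)
    then show ?thesis using i that counter_tape_dec[OF tapes[OF that]] tapes[OF that]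
      by (auto simp: ts' eq update_tape_scanned)
  next
    case (JZ y l)
    then show ?thesis using i that tapes[OF that] by (auto simp: ts' update_tape_scanned)
  next
    case (JMP l)
    then show ?thesis using i that tapes[OF that] by (auto simp: ts' update_tape_scanned)
  qed
  ultimately show ?thesis using st q' len' by (auto simp: counter_tapes_def)
qed

lemma counter_tm_simulates:
  assumes "\<forall>i\<in>set P. instr_var i < V" "counter_tapes V \<sigma> ts" "(code_step P ^^ k) (pc, \<sigma>) = (pc', \<sigma>')"
  shows "\<exists>ts'. (tm_step (counter_tm P V) ^^ k) (state_of_pc P pc, ts) = (state_of_pc P pc', ts') \<and> counter_tapes V \<sigma>' ts'"
  using assms(3)
proof (induction k arbitrary: pc' \<sigma>')
  case 0
  then show ?case using assms(2) by auto
next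
  case (Suc k)
  obtain pc1 \<sigma>1 where 1: "(code_step P ^^ k) (pc, \<sigma>) = (pc1, \<sigma>1)" by force
  from Suc.IH[OF 1] obtain ts1 where "(tm_step (counter_tm P V) ^^ k) (state_of_pc P pc, ts) = (state_of_pc P pc1, ts1)"
    "counter_tapes V \<sigma>1 ts1" by blast
  then show ?case
    using counter_tm_simulates_step[OF assms(1), of \<sigma>1 ts1 pc1 pc' \<sigma>'] Suc.prems 1 by auto
qed

lemma input_tape_append:
  "scanned (fst (input_tape (xs @ ys)), int (length xs)) = (case ys of [] \<Rightarrow> 0 | y # _ \<Rightarrow> if y then 2 else 1)"
  by (auto simp: input_tape_def nth_append split: list.splits)

text \<open>The extra step writes the markers. The rest \<open>r\<close> is arbitrary, so that the
  lemma serves accepted and rejected inputs alike.\<close>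

lemma counter_tm_reading:
  assumes p: "p = replicate m True @ r" and "V > 0" "n \<le> m"
  shows "\<exists>ts. tm_run (counter_tm P V) p (Suc n) = (2, ts) \<and>
    counter_tapes V (init_store n) ts \<and> ts ! 0 = (fst (input_tape p), int n)"
  using assms(3)
proof (induction n)
  case 0
  let ?ts = "input_tape p # replicate V blank_tape"
  obtain q ts where st: "tm_step (counter_tm P V) (0, ?ts) = (q, ts)" by force
  note step = counter_tm_step[OF _ _ st]
  have "q = 2" "length ts = Suc V" using step by (simp_all add: next_state_def)
  moreover have "counter_tape 0 (ts ! j)" if "0 < j" "j \<le> V" for j
    using step(3)[of j] that by (cases j) (auto simp: tape_action_def blank_tape_def counter_tape_def)
  moreover have "ts ! 0 = input_tape p"
    using step(3)[of 0] by (simp add: tape_action_def update_tape_scanned)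
  ultimately show ?case
    using st by (auto simp: init_store_def tm_run_Suc tm_run_0 tm_init_def counter_tm_def counter_tapes_def input_tape_def)
next
  case (Suc n)
  then obtain ts where ts: "tm_run (counter_tm P V) p (Suc n) = (2, ts)"
    "counter_tapes V (init_store n) ts" "ts ! 0 = (fst (input_tape p), int n)" by auto
  have len: "length ts = Suc V" using ts(2) by (simp add: counter_tapes_def)
  obtain q' ts' where st: "tm_step (counter_tm P V) (2, ts) = (q', ts')" by force
  note step = counter_tm_step[OF _ len st]
  have "p = replicate n True @ True # (replicate (m - Suc n) True @ r)"
    using Suc.prems p by (metis Cons_replicate_eq append.assoc append_Cons diff_Suc_Suc le_add_diff_inverse
        replicate_Suc replicate_add Suc_diff_Suc Suc_le_lessD less_imp_le)
  then have sc: "scanned (ts ! 0) = 2"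
    using input_tape_append[of "replicate n True" "True # (replicate (m - Suc n) True @ r)"] ts(3) by simp
  have "q' = 2" using step(1) sc len by (simp add: next_state_def nth_map[of 0])
  moreover have "length ts' = Suc V" using step(2) by simp
  moreover have "ts' ! 0 = (fst (input_tape p), int (Suc n))"
    using step(3)[of 0] sc ts(3) by (simp add: tape_action_def)
  moreover have "counter_tape ((init_store (Suc n)) x) (ts' ! (V - x))" if "x < V" for x
  proof -
    have "counter_tape ((init_store n) x) (ts ! (V - x))"
      using ts(2) that by (simp add: counter_tapes_def)
    then show ?thesis
      using step(3)[of "V - x"] that sc counter_tape_inc[of n "ts ! V"]
      by (cases "x = 0") (auto simp: init_store_def tape_action_def update_tape_scanned)
  qed
  ultimately show ?case using ts(1) st by (auto simp: tm_run_Suc counter_tapes_def)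
qed

text \<open>Inputs are rejected by idling: at a blank in state 2, or at a further bit in state 3,
  neither the state nor a tape changes any more.\<close>

lemma counter_tm_stuck:
  assumes "tm_run (counter_tm P V) p t = (q, ts)" "length ts = Suc V"
    and "q = 2 \<and> scanned (ts ! 0) = 0 \<or> q = 3 \<and> scanned (ts ! 0) \<noteq> 0"
  shows "p \<notin> tm_dom (counter_tm P V)"
proof (rule tm_run_stuck)
  obtain q' ts' where st: "tm_step (counter_tm P V) (q, ts) = (q', ts')" by force
  note step = counter_tm_step[OF _ assms(2) st]
  have "ts' = ts"
    using step(2,3) assms(2,3) by (intro nth_equalityI) (auto simp: tape_action_def update_tape_scanned less_Suc_eq_le)
  moreover have "q' = q"
    using step(1) assms(2,3) by (auto simp: next_state_def nth_map[of 0])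
  ultimately show "tm_step (counter_tm P V) (tm_run (counter_tm P V) p t) = tm_run (counter_tm P V) p t"
    using st assms(1) by simp
  show "fst (tm_run (counter_tm P V) p t) \<noteq> 1" using assms(1,3) by auto
qed

lemma counter_tm_read:
  assumes "p = replicate m True @ False # r" "V > 0"
  shows "\<exists>ts. tm_run (counter_tm P V) p (m + 2) = (3, ts) \<and>
    counter_tapes V (init_store m) ts \<and> ts ! 0 = (fst (input_tape p), int (m + 1))"
proof -
  obtain ts where ts: "tm_run (counter_tm P V) p (Suc m) = (2, ts)"
    "counter_tapes V (init_store m) ts" "ts ! 0 = (fst (input_tape p), int m)"
    using counter_tm_reading[OF assms, of m P] by auto
  have len: "length ts = Suc V" using ts(2) by (simp add: counter_tapes_def)
  obtain q' ts' where st: "tm_step (counter_tm P V) (2, ts) = (q', ts')" by force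
  note step = counter_tm_step[OF _ len st]
  have sc: "scanned (ts ! 0) = 1"
    using input_tape_append[of "replicate m True" "False # r"] ts(3) assms(1) by simp
  have "q' = 3" using step(1) sc len by (simp add: next_state_def nth_map[of 0])
  moreover have "length ts' = Suc V" using step(2) by simp
  moreover have "ts' ! 0 = (fst (input_tape p), int (m + 1))"
    using step(3)[of 0] sc ts(3) by (simp add: tape_action_def)
  moreover have "ts' ! (V - x) = ts ! (V - x)" if "x < V" for x
    using step(3)[of "V - x"] that sc by (simp add: tape_action_def update_tape_scanned)
  ultimately show ?thesis using ts(1,2) st by (auto simp: tm_run_Suc counter_tapes_def)
qed

text \<open>The reading routine alone decides this, whatever \<open>P\<close> does: an input without
  \<open>False\<close> idles in state 2, and one that continues after its first \<open>False\<close>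
  idles in state 3. Prefix-freeness follows.\<close>

lemma counter_tm_dom_subset:
  assumes "V > 0" "p \<in> tm_dom (counter_tm P V)"
  shows "\<exists>m. p = replicate m True @ [False]"
proof -
  define m where "m = length (takeWhile id p)"
  have tw: "takeWhile id p = replicate m True"
    unfolding m_def by (rule sym, rule replicate_length_same) (auto dest: set_takeWhileD)
  have p: "p = replicate m True @ dropWhile id p"
    using takeWhile_dropWhile_id[of id p] by (simp add: tw)
  show ?thesis
  proof (cases "dropWhile id p")
    case Nil
    obtain ts where "tm_run (counter_tm P V) p (Suc m) = (2, ts)"
      "counter_tapes V (init_store m) ts" "ts ! 0 = (fst (input_tape p), int m)"
      using counter_tm_reading[OF p assms(1), of m P] by auto
    then have "p \<notin> tm_dom (counter_tm P V)"
      using input_tape_append[of "replicate m True" "[]"] p Nil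
      by (intro counter_tm_stuck) (auto simp: counter_tapes_def)
    then show ?thesis using assms(2) by simp
  next
    case (Cons b r)
    then have "\<not> b" using hd_dropWhile[of id p] by auto
    with p Cons have p': "p = replicate m True @ False # r" by simp
    obtain ts where ts: "tm_run (counter_tm P V) p (m + 2) = (3, ts)"
      "counter_tapes V (init_store m) ts" "ts ! 0 = (fst (input_tape p), int (m + 1))"
      using counter_tm_read[OF p' assms(1)] by blast
    have "r = []"
    proof (rule ccontr)
      assume "r \<noteq> []"
      then have "scanned (ts ! 0) \<noteq> 0"
        using input_tape_append[of "replicate m True @ [False]" r] p' ts(3) by (auto split: list.splits)
      then have "p \<notin> tm_dom (counter_tm P V)"
        using ts by (intro counter_tm_stuck) (auto simp: counter_tapes_def)
      then show False using assms(2) by simp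
    qed
    then show ?thesis using p' by blast
  qed
qed

text \<open>Of the m + 3 steps, one writes the markers, m count, one reads \<open>False\<close>, and
  one sees the end of the input.\<close>

lemma counter_tm_start:
  assumes "V > 0"
  shows "\<exists>ts. tm_run (counter_tm P V) (replicate m True @ [False]) (m + 3) = (state_of_pc P 0, ts) \<and>
    counter_tapes V (init_store m) ts"
proof -
  let ?p = "replicate m True @ [False]"
  obtain ts where ts: "tm_run (counter_tm P V) ?p (m + 2) = (3, ts)"
    "counter_tapes V (init_store m) ts" "ts ! 0 = (fst (input_tape ?p), int (m + 1))"
    using counter_tm_read[OF refl assms] by blast
  have len: "length ts = Suc V" using ts(2) by (simp add: counter_tapes_def)
  obtain q' ts' where st: "tm_step (counter_tm P V) (3, ts) = (q', ts')" by force
  note step = counter_tm_step[OF _ len st]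
  have sc: "scanned (ts ! 0) = 0"
    using input_tape_append[of ?p "[]"] ts(3) by simp
  have "q' = state_of_pc P 0" using step(1) sc len by (simp add: next_state_def nth_map[of 0])
  moreover have "ts' = ts"
    using step(2,3) len by (intro nth_equalityI) (auto simp: tape_action_def update_tape_scanned less_Suc_eq_le)
  moreover have "tm_run (counter_tm P V) ?p (m + 3) = (q', ts')"
    using tm_run_Suc[of "counter_tm P V" ?p "m + 2"] ts(1) st by (simp add: numeral_eq_Suc)
  ultimately show ?thesis using ts(2) by blast
qed

theorem recf_realized_by_prefix_free_tm:
  assumes "recf f"
  obtains M where "prefix_free_tm M"
    "\<And>m. \<exists>out. replicate m True @ [False] \<in> tm_dom M \<and>
       tm_output M (replicate m True @ [False]) = Some out \<and> length out \<ge> f m"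
proof -
  obtain c where c: "evaluates 0 c f" using recf_imp_evaluates[OF assms] by blast
  define P where "P = compile 0 c"
  \<comment> \<open>The 0 is inserted because variable 0 carries argument and result and needs a
    tape even if no instruction mentions it.\<close>
  define V where "V = Suc (Max (insert 0 (instr_var ` set P)))"
  have V: "\<forall>i\<in>set P. instr_var i < V" "V > 0"
    by (auto simp: V_def less_Suc_eq_le intro: Max_ge)
  let ?M = "counter_tm P V"
  show thesis
  proof (rule that[of ?M])
    have "p = q" if "prefix p q" "p = replicate m True @ [False]" "q = replicate n True @ [False]" for p q m n
    proof -
      from that(1) obtain r where "q = p @ r" by (rule prefixE)
      with that(2,3) have r: "replicate n True @ [False] = replicate m True @ False # r" by simp
      \<comment> \<open>The number of leading \<open>True\<close> bits can be read off any
        extension, so a prefix in the domain has the same \<open>m\<close>.\<close>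
      have "takeWhile id (replicate k True @ False # s) = replicate k True" for k s
        by (induction k) auto
      from this[of n "[]"] this[of m r] r have "replicate n True = replicate m True" by simp
      then show ?thesis using that by simp
    qed
    then have "p = q" if "p \<in> tm_dom ?M" "q \<in> tm_dom ?M" "prefix p q" for p q
      using counter_tm_dom_subset[OF V(2) that(1)] counter_tm_dom_subset[OF V(2) that(2)] that(3) by blast
    then show "prefix_free_tm ?M"
      by (simp add: prefix_free_tm_def wf_counter_tm)
    fix m
    let ?p = "replicate m True @ [False]"
    obtain ts where ts: "tm_run ?M ?p (m + 3) = (state_of_pc P 0, ts)" "counter_tapes V (init_store m) ts"
      using counter_tm_start[OF V(2)] by blast
    obtain \<sigma>' where \<sigma>': "exec c (init_store m) \<sigma>'" "\<sigma>' 0 = f m"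
      using c by (rule evaluatesD[where \<sigma> = "init_store m"]) (auto simp: init_store_def)
    obtain k where k: "(code_step P ^^ k) (0, init_store m) = (length P, \<sigma>')"
      using compile_correct[OF \<sigma>'(1), of P "[]" "[]"] by (auto simp: P_def)
    obtain ts' where ts': "tm_run ?M ?p (m + 3 + k) = (1, ts')" "counter_tapes V \<sigma>' ts'"
      using counter_tm_simulates[OF V(1) ts(2) k] ts(1) by (auto simp: tm_run_add state_of_pc_def)
    \<comment> \<open>Variable 0 lies on tape \<open>V\<close>, the last one, which is the output
      tape. The marker in cell 0 also counts as a bit, so cells 0 to \<open>f m\<close> - 1 are all
      bits.\<close>
    have "counter_tape (f m) (last ts')"
      using ts'(2) V(2) \<sigma>'(2) by (cases ts') (auto simp: counter_tapes_def last_conv_nth)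
    then have "fst (last ts') (int i) \<in> {1, 2}" if "i < f m" for i
      using that by (cases "i = 0") (auto simp: counter_tape_def)
    then obtain out where "tm_output ?M ?p = Some out" "length out \<ge> f m"
      using length_tm_output_ge[OF wf_counter_tm, of P V ?p "m + 3 + k" "f m"] ts'(1) by auto
    moreover have "?p \<in> tm_dom ?M"
      using ts'(1) by (auto simp: tm_dom_def intro!: exI[of _ "m + 3 + k"])
    ultimately show "\<exists>out. ?p \<in> tm_dom ?M \<and> tm_output ?M ?p = Some out \<and> length out \<ge> f m" by blast
  qed
qed

section \<open>Computable complex numbers\<close>

type_synonym nat5 = "nat \<times> nat \<times> nat \<times> nat \<times> nat"

text \<open>Gaussian rationals are given by the positive and negative parts of both numerators and the
  predecessor of the common denominator.\<close>

fun gauss :: "nat5 \<Rightarrow> complex" where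
  "gauss (p, q, r, s, d) = (of_nat p - of_nat q + \<i> * (of_nat r - of_nat s)) / of_nat (Suc d)"

instantiation complex :: numbered
begin
definition num_complex :: "nat \<Rightarrow> complex" where "num_complex n = gauss (num n)"
instance ..
end

lemma num_complex_prod: "(num n :: complex \<times> complex) = map_prod gauss gauss (num n)"
  by (cases "prod_decode n") (simp add: num_prod_def num_complex_def)

lemma computable_gauss:
  assumes "computable f"
  shows "computable (\<lambda>x. gauss (f x))"
  using assms unfolding computable_def num_complex_def by metis

text \<open>Reduces an operation on Gaussian rationals to natural number arithmetic on the five
  components of their representations.\<close>

lemma computable_complex_binop:
  assumes G: "computable G" and eq: "\<And>x y. gauss (G (x, y)) = h (gauss x) (gauss y)"
    and "computable f" "computable g"
  shows "computable (\<lambda>x. h (f x) (g x))"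
proof -
  obtain G' where G': "recf G'" "\<And>n. num (G' n) = G (num n)"
    using G by (auto simp: computable_def)
  have "computable (\<lambda>p. h (fst p) (snd p))"
  proof (rule computableI[OF G'(1)])
    fix n
    obtain x y where xy: "(num n :: nat5 \<times> nat5) = (x, y)" by (rule prod.exhaust)
    then show "num (G' n) = h (fst (num n :: complex \<times> complex)) (snd (num n :: complex \<times> complex))"
      by (simp add: num_complex_def num_complex_prod G'(2) eq)
  qed
  from computable_comp[OF this computable_Pair[OF assms(3,4)]] show ?thesis by simp
qed

lemma computable_complex_add [computable_intros]:
  assumes "computable f" "computable g"
  shows "computable (\<lambda>x. f x + g x :: complex)"
proof (rule computable_complex_binop[where h = "(+)", OF _ _ assms])
  \<comment> \<open>The last component is the predecessor of the product of the denominators.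
    Fractions are not reduced, as codes need not be unique.\<close>
  define G :: "nat5 \<times> nat5 \<Rightarrow> nat5" where
    "G = (\<lambda>u. let (p, q, r, s, d) = fst u; (p', q', r', s', d') = snd u in
      (p * Suc d' + p' * Suc d, q * Suc d' + q' * Suc d, r * Suc d' + r' * Suc d, s * Suc d' + s' * Suc d,
       d * d' + d + d'))"
  show "computable G"
    unfolding G_def Let_def case_prod_beta by (intro computable_intros)
  show "gauss (G (x, y)) = gauss x + gauss y" for x y
  proof -
    obtain p q r s d p' q' r' s' d' where [simp]: "x = (p, q, r, s, d)" "y = (p', q', r', s', d')"
      by (metis prod_cases5)
    have D: "of_nat (Suc (d * d' + d + d')) = (of_nat (Suc d) * of_nat (Suc d') :: complex)"
      by (simp add: algebra_simps)
    show ?thesis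
      unfolding G_def by (simp add: D add_divide_eq_iff divide_add_eq_iff del: of_nat_Suc) (simp add: algebra_simps)
  qed
qed

lemma computable_complex_mult [computable_intros]:
  assumes "computable f" "computable g"
  shows "computable (\<lambda>x. f x * g x :: complex)"
proof (rule computable_complex_binop[where h = "(*)", OF _ _ assms])
  define G :: "nat5 \<times> nat5 \<Rightarrow> nat5" where
    "G = (\<lambda>u. let (p, q, r, s, d) = fst u; (p', q', r', s', d') = snd u in
      (p * p' + q * q' + r * s' + s * r', p * q' + q * p' + r * r' + s * s',
       p * r' + q * s' + r * p' + s * q', p * s' + q * r' + r * q' + s * p', d * d' + d + d'))"
  show "computable G"
    unfolding G_def Let_def case_prod_beta by (intro computable_intros)
  show "gauss (G (x, y)) = gauss x * gauss y" for x y
  proof -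
    obtain p q r s d p' q' r' s' d' where [simp]: "x = (p, q, r, s, d)" "y = (p', q', r', s', d')"
      by (metis prod_cases5)
    have D: "of_nat (Suc (d * d' + d + d')) = (of_nat (Suc d) * of_nat (Suc d') :: complex)"
      by (simp add: algebra_simps)
    have *: "\<i> * (\<i> * z) = - z" for z by (simp flip: mult.assoc)
    show ?thesis
      unfolding G_def by (simp add: D del: of_nat_Suc) (simp add: algebra_simps * del: of_nat_Suc)
  qed
qed

lemma computable_of_nat [computable_intros]:
  assumes "computable f"
  shows "computable (\<lambda>x. of_nat (f x) :: complex)"
proof -
  have "computable (\<lambda>x. gauss (f x, 0, 0, 0, 0))"
    using assms by (intro computable_gauss computable_intros)
  then show ?thesis by simp
qed

lemma computable_inverse_Suc [computable_intros]:
  assumes "computable f"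
  shows "computable (\<lambda>x. inverse (of_nat (Suc (f x))) :: complex)"
proof -
  have "computable (\<lambda>x. gauss (1, 0, 0, 0, f x))"
    using assms by (intro computable_gauss computable_intros)
  then show ?thesis by (simp add: inverse_eq_divide)
qed

lemma computable_const_gauss: "computable (\<lambda>_. gauss u)"
proof -
  obtain p q r s d where u: "u = (p, q, r, s, d)" by (metis prod_cases5)
  show ?thesis unfolding u by (intro computable_gauss computable_intros)
qed

lemma computable_0 [computable_intros]: "computable (\<lambda>_. 0 :: complex)"
  and computable_1 [computable_intros]: "computable (\<lambda>_. 1 :: complex)"
  using computable_const_gauss[of "(0, 0, 0, 0, 0)"] computable_const_gauss[of "(1, 0, 0, 0, 0)"] by simp_all

lemma computable_complex_minus [computable_intros]:
  assumes "computable f"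
  shows "computable (\<lambda>x. - f x :: complex)"
proof -
  have "computable (\<lambda>x. gauss (0, 1, 0, 0, 0) * f x)"
    using assms by (intro computable_intros computable_const_gauss)
  then show ?thesis by simp
qed

lemma computable_complex_diff [computable_intros]:
  assumes "computable f" "computable g"
  shows "computable (\<lambda>x. f x - g x :: complex)"
proof -
  have "computable (\<lambda>x. f x + - g x)"
    using assms by (intro computable_intros)
  then show ?thesis by simp
qed

text \<open>The test is exact because coded numbers are Gaussian rationals: the denominator is
  positive, so the two parts of the real numerator decide. The search for a halting time rests on
  this test.\<close>

lemma decidable_Re_neg [computable_intros]:
  assumes "computable f"
  shows "decidable (\<lambda>x. Re (f x) < 0)"
proof -
  have "decidable (\<lambda>u :: nat5. fst u < fst (snd u))"
    by (intro computable_intros)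
  then obtain G where G: "recf G" "\<And>n. G n = of_bool (fst (num n :: nat5) < fst (snd (num n :: nat5)))"
    unfolding decidable_def computable_def num_nat_def by blast
  have "computable (\<lambda>z. of_bool (Re z < 0) :: nat)"
  proof (rule computableI[OF G(1)])
    fix n
    obtain p q r s d where u: "(num n :: nat5) = (p, q, r, s, d)" by (metis prod_cases5)
    have "gauss (p, q, r, s, d) = Complex ((real p - real q) / Suc d) ((real r - real s) / Suc d)"
      by (simp add: complex_eq_iff Re_divide_of_nat Im_divide_of_nat del: of_nat_Suc)
    then show "(num (G n) :: nat) = of_bool (Re (num n) < 0)"
      by (simp add: num_nat_def num_complex_def G(2) u divide_less_0_iff del: gauss.simps)
  qed
  from computable_comp[OF this assms] show ?thesis by (simp add: decidable_def)
qed

lemma computable_complex_power [computable_intros]: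
  assumes "computable f" "computable g"
  shows "computable (\<lambda>x. f x ^ g x :: complex)"
proof -
  have "computable (\<lambda>x. ((\<lambda>a. f x * a) ^^ g x) 1)"
    using assms by (intro computable_intros computable_comp[OF assms(1)])
  moreover have "((\<lambda>a. m * a) ^^ k) 1 = m ^ k" for k and m :: complex
    by (induction k) simp_all
  ultimately show ?thesis by simp
qed

lemma computable_sum [computable_intros]:
  fixes f :: "'a::numbered \<Rightarrow> nat \<Rightarrow> complex"
  assumes f: "computable (\<lambda>p. f (fst p) (snd p))" and n: "computable n"
  shows "computable (\<lambda>x. \<Sum>k<n x. f x k)"
proof -
  let ?F = "\<lambda>x u. (Suc (fst u), snd u + f x (fst u))"
  have "computable (\<lambda>q :: 'a \<times> nat \<times> complex. f (fst q) (fst (snd q)))"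
    using computable_comp[OF f, of "\<lambda>q. (fst q, fst (snd q))"] by (simp add: computable_intros)
  then have "computable (\<lambda>x. snd ((?F x ^^ n x) (0, 0)))"
    by (intro computable_intros n)
  moreover have "(?F x ^^ k) (0, 0) = (k, \<Sum>j<k. f x j)" for x k
    by (induction k) simp_all
  ultimately show ?thesis by simp
qed

text \<open>The constant \<open>K\<close> need not be computable: it absorbs the Lipschitz constants and the finitely
  many bad indices that come up below.\<close>

definition computable_number :: "complex \<Rightarrow> bool" where
  "computable_number z \<longleftrightarrow>
    (\<exists>c :: nat \<Rightarrow> complex. \<exists>K. computable c \<and> (\<forall>n. cmod (c n - z) \<le> K * (1 / 2) ^ n))"

lemma computable_numberI:
  assumes "computable c" "\<And>n. n \<ge> N \<Longrightarrow> cmod (c n - z) \<le> K * (1 / 2) ^ n"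
  shows "computable_number z"
proof -
  \<comment> \<open>The weight \<open>2 ^ n\<close> turns the n-th summand times
    \<open>(1 / 2) ^ n\<close> into exactly the error at index n.\<close>
  define K' where "K' = \<bar>K\<bar> + (\<Sum>n<N. cmod (c n - z) * 2 ^ n)"
  have "cmod (c n - z) \<le> K' * (1 / 2) ^ n" for n
  proof (cases "n < N")
    case True
    have "cmod (c n - z) * 2 ^ n \<le> (\<Sum>n<N. cmod (c n - z) * 2 ^ n)"
      using True by (intro member_le_sum) auto
    then have "cmod (c n - z) * 2 ^ n \<le> K'" by (simp add: K'_def)
    then show ?thesis by (simp add: power_one_over field_simps)
  next
    case False
    have "K \<le> K'" unfolding K'_def
      by (smt (verit) sum_nonneg norm_ge_zero mult_nonneg_nonneg zero_le_power)
    with assms(2)[of n] False show ?thesis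
      by (smt (verit) mult_right_mono zero_le_power divide_nonneg_nonneg not_le)
  qed
  with assms(1) show ?thesis unfolding computable_number_def by blast
qed

lemma computable_number_gauss: "computable_number (gauss u)"
  by (rule computable_numberI[OF computable_const_gauss[of u], where K = 0]) simp

lemma computable_number_rat:
  assumes "x \<in> \<rat>"
  shows "computable_number (of_real x)"
proof -
  from assms obtain a :: int and b :: nat where "b > 0" "x = of_int a / of_nat b"
    by (metis Rats_cases' zero_less_imp_eq_int of_int_of_nat_eq of_nat_0_less_iff)
  then have "of_real x = gauss (nat a, nat (- a), 0, 0, b - 1)"
    by (cases "a \<ge> 0") auto
  then show ?thesis by (simp only: computable_number_gauss)
qed

lemma computable_number_ii: "computable_number \<i>"
  using computable_number_gauss[of "(0, 0, 1, 0, 0)"] by simp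

lemma computable_number_1: "computable_number 1"
  using computable_number_gauss[of "(1, 0, 0, 0, 0)"] by simp

lemma computable_number_add:
  assumes "computable_number y" "computable_number z"
  shows "computable_number (y + z)"
proof -
  obtain c d :: "nat \<Rightarrow> complex" and K L where c: "computable c" "\<And>n. cmod (c n - y) \<le> K * (1 / 2) ^ n"
    and d: "computable d" "\<And>n. cmod (d n - z) \<le> L * (1 / 2) ^ n"
    using assms unfolding computable_number_def by blast
  show ?thesis
  proof (rule computable_numberI)
    show "computable (\<lambda>n. c n + d n)" using c(1) d(1) by (intro computable_intros)
    show "cmod (c n + d n - (y + z)) \<le> (K + L) * (1 / 2) ^ n" for n
      using norm_triangle_ineq[of "c n - y" "d n - z"] c(2)[of n] d(2)[of n]
      by (simp add: algebra_simps)
  qed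
qed

lemma computable_number_mult:
  assumes "computable_number y" "computable_number z"
  shows "computable_number (y * z)"
proof -
  obtain c d :: "nat \<Rightarrow> complex" and K L where c: "computable c" "\<And>n. cmod (c n - y) \<le> K * (1 / 2) ^ n"
    and d: "computable d" "\<And>n. cmod (d n - z) \<le> L * (1 / 2) ^ n"
    using assms unfolding computable_number_def by blast
  have K: "K \<ge> 0" using order_trans[OF norm_ge_zero c(2)[of 0]] by simp
  have L: "L \<ge> 0" using order_trans[OF norm_ge_zero d(2)[of 0]] by simp
  show ?thesis
  proof (rule computable_numberI)
    show "computable (\<lambda>n. c n * d n)" using c(1) d(1) by (intro computable_intros)
    fix n
    have "K * (1 / 2) ^ n \<le> K * 1" using K by (intro mult_left_mono power_le_one) auto
    then have "cmod (c n) \<le> cmod y + K"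
      using c(2)[of n] norm_triangle_ineq2[of "c n" y] by linarith
    then have "cmod (c n) * cmod (d n - z) \<le> (cmod y + K) * (L * (1 / 2) ^ n)"
      using K by (intro mult_mono d(2)) auto
    moreover have "cmod (c n - y) * cmod z \<le> K * (1 / 2) ^ n * cmod z"
      by (intro mult_right_mono c(2)) auto
    moreover have "cmod (c n * d n - y * z) \<le> cmod (c n) * cmod (d n - z) + cmod (c n - y) * cmod z"
    proof -
      have "c n * d n - y * z = c n * (d n - z) + (c n - y) * z" by (simp add: algebra_simps)
      then show ?thesis using norm_triangle_ineq[of "c n * (d n - z)" "(c n - y) * z"] by (simp add: norm_mult)
    qed
    ultimately show "cmod (c n * d n - y * z) \<le> ((cmod y + K) * L + K * cmod z) * (1 / 2) ^ n"
      by (simp add: algebra_simps)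
  qed
qed

lemma computable_number_minus: "computable_number z \<Longrightarrow> computable_number (- z)"
  using computable_number_mult[of "gauss (0, 1, 0, 0, 0)" z] by (simp add: computable_number_gauss del: gauss.simps) simp

lemma computable_number_diff: "computable_number y \<Longrightarrow> computable_number z \<Longrightarrow> computable_number (y - z)"
  using computable_number_add[of y "- z"] computable_number_minus[of z] by simp

lemma computable_number_power: "computable_number z \<Longrightarrow> computable_number (z ^ n)"
  by (induction n) (simp_all add: computable_number_1 computable_number_mult)

section \<open>Power series, exponential and logarithm of computable numbers\<close>

lemma sum_nat_mult_half_power_le: "(\<Sum>k<n. real k * (1 / 2) ^ k) \<le> 2"
proof -
  have "(\<Sum>k<n. real k * (1 / 2) ^ k) = 2 - 2 * (real n + 1) * (1 / 2) ^ n"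
  proof (induction n)
    case (Suc n)
    have "2 - 2 * (real n + 1) * h + real n * h = 2 - 2 * (real (Suc n) + 1) * (1 / 2 * h)" for h :: real
      by (simp add: algebra_simps)
    then show ?case by (simp only: sum.lessThan_Suc Suc.IH power_Suc)
  qed simp
  also have "\<dots> \<le> 2" by simp
  finally show ?thesis .
qed

text \<open>Doubling moves both points into the unit disc, where \<open>norm_power_diff\<close>
  applies, and scaling back gains \<open>(1 / 2) ^ k\<close>. Since the factors
  \<open>real k * (1 / 2) ^ k\<close> have bounded sums, truncated power series get a Lipschitz
  constant independent of the number of terms.\<close>

lemma norm_power_diff_half:
  fixes y z :: complex
  assumes "cmod y \<le> 1 / 2" "cmod z \<le> 1 / 2"
  shows "cmod (y ^ k - z ^ k) \<le> 2 * cmod (y - z) * (real k * (1 / 2) ^ k)"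
proof -
  have "cmod ((2 * y) ^ k - (2 * z) ^ k) \<le> real k * cmod (2 * y - 2 * z)"
    using assms by (intro norm_power_diff) (simp_all add: norm_mult)
  moreover have "cmod ((2 * y) ^ k - (2 * z) ^ k) = 2 ^ k * cmod (y ^ k - z ^ k)"
    unfolding power_mult_distrib right_diff_distrib[symmetric] by (simp add: norm_mult norm_power)
  moreover have "cmod (2 * y - 2 * z) = 2 * cmod (y - z)"
    by (metis norm_mult norm_numeral right_diff_distrib)
  ultimately have "2 ^ k * cmod (y ^ k - z ^ k) \<le> real k * (2 * cmod (y - z))"
    by simp
  then show ?thesis by (simp add: power_one_over field_simps)
qed

text \<open>The first n terms are evaluated at the n-th approximation. Moving the argument costs
  \<open>4 * K * (1 / 2) ^ n\<close> and the tail at most \<open>2 * (1 / 2) ^ n\<close>. Radius 1/4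
  leaves room for approximations with error below 1/4 to stay within 1/2.\<close>

lemma computable_number_power_series:
  fixes a :: "nat \<Rightarrow> complex"
  assumes a: "computable a" "\<And>k. cmod (a k) \<le> 1" and z: "computable_number z" "cmod z \<le> 1 / 4"
    and s: "(\<lambda>k. a k * z ^ k) sums s"
  shows "computable_number s"
proof -
  obtain c :: "nat \<Rightarrow> complex" and K where c: "computable c" "\<And>n. cmod (c n - z) \<le> K * (1 / 2) ^ n"
    using z(1) unfolding computable_number_def by blast
  have "(\<lambda>n. K * (1 / 2) ^ n) \<longlonglongrightarrow> K * 0"
    by (intro tendsto_intros LIMSEQ_power_zero) simp
  then have "eventually (\<lambda>n. K * (1 / 2) ^ n < 1 / 4) sequentially"
    by (intro order_tendstoD(2)) auto
  then obtain N where N: "\<And>n. n \<ge> N \<Longrightarrow> K * (1 / 2) ^ n < 1 / 4"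
    unfolding eventually_sequentially by blast
  show ?thesis
  proof (rule computable_numberI)
    show "computable (\<lambda>n. \<Sum>k<n. a k * c n ^ k)"
      by (intro computable_intros computable_comp[OF a(1)] computable_comp[OF c(1)])
    fix n assume n: "n \<ge> N"
    have cn: "cmod (c n) \<le> 1 / 2"
      using norm_triangle_ineq2[of "c n" z] c(2)[of n] N[OF n] z(2) by linarith
    have "cmod ((\<Sum>k<n. a k * c n ^ k) - (\<Sum>k<n. a k * z ^ k)) = cmod (\<Sum>k<n. a k * (c n ^ k - z ^ k))"
      by (simp add: sum_subtractf algebra_simps)
    also have "\<dots> \<le> (\<Sum>k<n. 2 * cmod (c n - z) * (real k * (1 / 2) ^ k))"
    proof (rule sum_norm_le)
      fix k
      have "cmod (a k * (c n ^ k - z ^ k)) \<le> 1 * cmod (c n ^ k - z ^ k)"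
        unfolding norm_mult by (intro mult_right_mono a(2)) simp
      also have "\<dots> \<le> 2 * cmod (c n - z) * (real k * (1 / 2) ^ k)"
        using norm_power_diff_half[of "c n" z k] cn z(2) by simp
      finally show "cmod (a k * (c n ^ k - z ^ k)) \<le> 2 * cmod (c n - z) * (real k * (1 / 2) ^ k)" .
    qed
    also have "\<dots> \<le> 2 * cmod (c n - z) * 2"
      unfolding sum_distrib_left[symmetric] by (intro mult_left_mono sum_nat_mult_half_power_le) simp
    also have "\<dots> \<le> 4 * K * (1 / 2) ^ n" using c(2)[of n] by simp
    finally have 1: "cmod ((\<Sum>k<n. a k * c n ^ k) - (\<Sum>k<n. a k * z ^ k)) \<le> 4 * K * (1 / 2) ^ n" .
    have "(\<lambda>k. a (k + n) * z ^ (k + n)) sums (s - (\<Sum>k<n. a k * z ^ k))"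
      using sums_iff_shift[of "\<lambda>k. a k * z ^ k" n "s - (\<Sum>k<n. a k * z ^ k)"] s by simp
    moreover have "(\<lambda>k. (1 / 2) ^ n * (1 / 2) ^ k) sums ((1 / 2) ^ n * (1 / (1 - 1 / 2)) :: real)"
      by (intro sums_mult geometric_sums) simp
    moreover have "cmod (a (k + n) * z ^ (k + n)) \<le> (1 / 2) ^ n * (1 / 2) ^ k" for k
    proof -
      have "cmod (a (k + n) * z ^ (k + n)) \<le> 1 * cmod z ^ (k + n)"
        unfolding norm_mult norm_power by (intro mult_right_mono a(2)) simp
      also have "\<dots> \<le> (1 / 2) ^ (k + n)" using z(2) by (simp add: power_mono)
      finally show ?thesis by (simp add: power_add mult.commute)
    qed
    ultimately have 2: "cmod (s - (\<Sum>k<n. a k * z ^ k)) \<le> (1 / 2) ^ n * (1 / (1 - 1 / 2))"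
      by (metis (no_types, lifting) norm_suminf_le sums_iff)
    show "cmod ((\<Sum>k<n. a k * c n ^ k) - s) \<le> (4 * K + 2) * (1 / 2) ^ n"
      using norm_triangle_ineq4[of "(\<Sum>k<n. a k * c n ^ k) - (\<Sum>k<n. a k * z ^ k)" "s - (\<Sum>k<n. a k * z ^ k)"] 1 2
      by (simp add: algebra_simps)
  qed
qed

lemma computable_inverse_fact: "computable (\<lambda>k. inverse (fact k) :: complex)"
proof -
  let ?F = "\<lambda>u :: nat \<times> complex. (Suc (fst u), snd u * inverse (of_nat (Suc (fst u))))"
  have "computable (\<lambda>k :: nat. snd ((?F ^^ k) (0, 1)))"
    by (intro computable_intros)
  moreover have "(?F ^^ k) (0, 1) = (k, inverse (fact k))" for k
    by (induction k) (simp_all add: field_simps)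
  ultimately show ?thesis by simp
qed

text \<open>Reduced to the small disc by \<open>exp z = exp (z / N) ^ N\<close>, where
  \<open>N\<close> depends on \<open>z\<close> but is fixed.\<close>

lemma computable_number_exp:
  assumes "computable_number z"
  shows "computable_number (exp z)"
proof -
  obtain N :: nat where N: "4 * cmod z \<le> real N" "N > 0"
  proof -
    obtain N :: nat where "4 * cmod z \<le> real N" using real_arch_simple by blast
    then show ?thesis by (intro that[of "Suc N"]) auto
  qed
  define v where "v = z * of_real (1 / real N)"
  have v: "computable_number v"
    unfolding v_def by (intro computable_number_mult assms computable_number_rat) simp
  have v': "cmod v \<le> 1 / 4"
    unfolding v_def norm_mult norm_of_real using N by (simp add: field_simps)
  have s: "(\<lambda>k. inverse (fact k) * v ^ k) sums exp v"
    using exp_converges[of v] by (simp add: scaleR_conv_of_real)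
  have "cmod (inverse (fact k)) \<le> 1" for k
    by (simp add: norm_inverse inverse_le_1_iff)
  from computable_number_power_series[OF computable_inverse_fact this v v' s]
  have "computable_number (exp v)" .
  then have "computable_number (exp v ^ N)" by (rule computable_number_power)
  moreover have "exp v ^ N = exp z"
    using N(2) by (simp add: v_def flip: exp_of_nat_mult)
  ultimately show ?thesis by simp
qed

text \<open>One factor \<open>v\<close> is split off so that the series starts at index 0 with
  coefficients of modulus at most 1 whose denominators are successors. Recovering the series
  requires division by \<open>v\<close>, hence the separate case \<open>v = 0\<close>.\<close>

lemma computable_number_Ln_near_1:
  assumes "computable_number v" "cmod v \<le> 1 / 4"
  shows "computable_number (ln (1 + v))"
proof -
  let ?a = "\<lambda>k. (- 1) ^ k * inverse (of_nat (Suc k)) :: complex"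
  have "(\<lambda>k. (- 1) ^ Suc k / of_nat k * v ^ k) sums ln (1 + v)"
    using assms(2) by (intro Ln_series) simp
  then have "(\<lambda>k. (- 1) ^ Suc (Suc k) / of_nat (Suc k) * v ^ Suc k) sums ln (1 + v)"
    using sums_Suc_iff[of "\<lambda>k. (- 1) ^ Suc k / of_nat k * v ^ k" "ln (1 + v)"] by simp
  then have s: "(\<lambda>k. v * (?a k * v ^ k)) sums ln (1 + v)"
    by (simp add: field_simps del: of_nat_Suc)
  show ?thesis
  proof (cases "v = 0")
    case True
    then show ?thesis using computable_number_gauss[of "(0, 0, 0, 0, 0)"] by simp
  next
    case False
    with s have "(\<lambda>k. ?a k * v ^ k) sums (ln (1 + v) / v)"
      using sums_mult[OF s, of "inverse v"] by (simp add: field_simps)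
    moreover have "computable ?a" by (intro computable_intros)
    moreover have "cmod (?a k) \<le> 1" for k
      by (simp add: norm_mult norm_power norm_inverse inverse_le_1_iff del: of_nat_Suc)
    ultimately have "computable_number (ln (1 + v) / v)"
      using computable_number_power_series[of ?a v] assms by blast
    from computable_number_mult[OF assms(1) this] show ?thesis using False by simp
  qed
qed

text \<open>No branch of the logarithm needs to be chosen effectively: up to a Gaussian rational \<open>w\<close> near
  \<open>ln b\<close>, the logarithm is that of \<open>b * exp (- w)\<close>, which is close to 1.\<close>

lemma computable_number_Ln:
  assumes "computable_number b" "b \<noteq> 0"
  shows "computable_number (ln b)"
proof -
  have "isCont (\<lambda>u. exp u :: complex) 0" by (intro continuous_intros)
  then have "\<exists>\<delta>>0. \<forall>u. dist u 0 < \<delta> \<longrightarrow> dist (exp u) (exp (0 :: complex)) < 1 / 4"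
    unfolding continuous_at_eps_delta by (elim allE[of _ "1 / 4"]) simp
  then obtain \<delta> where \<delta>: "\<delta> > 0" "\<And>u. cmod u < \<delta> \<Longrightarrow> cmod (exp u - 1) < 1 / 4"
    by (auto simp: dist_norm)
  \<comment> \<open>Half of \<delta> because \<open>cmod u\<close> is at most the sum of the moduli
    of its two parts; the bound 1, below pi, keeps \<open>Im u\<close> in the principal strip, so
    that \<open>ln (exp u) = u\<close>.\<close>
  define \<epsilon> where "\<epsilon> = min (\<delta> / 2) 1"
  have "\<epsilon> > 0" using \<delta>(1) by (simp add: \<epsilon>_def)
  obtain x y where x: "x \<in> \<rat>" "Re (ln b) < x" "x < Re (ln b) + \<epsilon>" and y: "y \<in> \<rat>" "Im (ln b) < y" "y < Im (ln b) + \<epsilon>"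
    using Rats_dense_in_real[of "Re (ln b)" "Re (ln b) + \<epsilon>"] Rats_dense_in_real[of "Im (ln b)" "Im (ln b) + \<epsilon>"] \<open>\<epsilon> > 0\<close>
    by auto
  define w where "w = of_real x + \<i> * of_real y"
  define u where "u = ln b - w"
  have w: "computable_number w"
    unfolding w_def using x(1) y(1)
    by (intro computable_number_add computable_number_mult computable_number_ii computable_number_rat)
  have "\<bar>Re u\<bar> < \<epsilon>" "\<bar>Im u\<bar> < \<epsilon>" using x y by (auto simp: u_def w_def)
  then have "cmod u < \<delta>" "\<bar>Im u\<bar> < pi"
    using cmod_le[of u] pi_gt3 by (auto simp: \<epsilon>_def)
  define v where "v = exp u - 1"
  have "exp u = b * exp (- w)" using assms(2) by (simp add: u_def exp_diff exp_minus divide_inverse)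
  then have "computable_number v"
    unfolding v_def using w assms(1)
    by (auto intro!: computable_number_diff computable_number_1 computable_number_mult computable_number_exp computable_number_minus)
  then have "computable_number (ln (1 + v))"
    using \<delta>(2)[OF \<open>cmod u < \<delta>\<close>] by (intro computable_number_Ln_near_1) (auto simp: v_def)
  moreover have "ln (1 + v) = u"
    using \<open>\<bar>Im u\<bar> < pi\<close> by (simp add: v_def Ln_exp)
  ultimately have "computable_number (w + u)" using w by (intro computable_number_add) auto
  then show ?thesis by (simp add: u_def)
qed

lemma computable_number_eml_value: "eml_value \<phi> = Some z \<Longrightarrow> computable_number z"
proof (induction \<phi> arbitrary: z)
  case One
  then show ?case using computable_number_1 by simp
next
  case (E \<alpha> \<beta>)
  then show ?case
    by (auto split: option.splits if_splits intro!: computable_number_diff computable_number_exp computable_number_Ln)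
qed

section \<open>Simulation of Turing machines\<close>

text \<open>On codes this is the identity, since \<open>num\<close> on pairs of natural numbers is
  \<open>prod_decode\<close>; the same holds for decoding.\<close>

lemma computable_prod_encode [computable_intros]:
  fixes f :: "'a::numbered \<Rightarrow> nat \<times> nat"
  assumes "computable f"
  shows "computable (\<lambda>x. prod_encode (f x))"
proof -
  obtain g where "recf g" "\<And>n. num (g n) = f (num n)"
    using assms by (auto simp: computable_def)
  then show ?thesis
    by (intro computableI[of g]) (auto simp: num_prod_def num_nat_def map_prod_def split_beta prod_eq_iff
        intro!: prod_decode_eq[THEN iffD1])
qed

lemma computable_prod_decode [computable_intros]:
  assumes "computable f"
  shows "computable (\<lambda>x. prod_decode (f x))"
proof -
  obtain g where "recf g" "\<And>n. num (g n) = f (num n)"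
    using assms by (auto simp: computable_def)
  then show ?thesis
    by (intro computableI[of g]) (auto simp: num_prod_def num_nat_def map_prod_def split_beta prod_eq_iff)
qed

lemma computable_div2_mod2:
  assumes "computable f"
  shows "computable (\<lambda>x. (f x div 2, f x mod 2 :: nat))"
proof -
  let ?F = "\<lambda>u :: nat \<times> nat. if snd u = 0 then (fst u, 1 :: nat) else (Suc (fst u), 0)"
  have "computable (\<lambda>x. (?F ^^ f x) (0, 0))"
    using assms by (intro computable_intros)
  moreover have "(?F ^^ n) (0, 0) = (n div 2, n mod 2)" for n
    by (induction n) (auto simp: div_Suc mod_Suc)
  ultimately show ?thesis by simp
qed

lemma computable_div2 [computable_intros]: "computable f \<Longrightarrow> computable (\<lambda>x. f x div 2 :: nat)"
  using computable_fst[OF computable_div2_mod2] by simp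

lemma decidable_even [computable_intros]:
  assumes "computable f"
  shows "decidable (\<lambda>x. even (f x :: nat))"
  unfolding even_iff_mod_2_eq_zero
  using decidable_eq[OF computable_snd[OF computable_div2_mod2[OF assms]], of "\<lambda>_. 0"]
  by (simp add: computable_intros)

text \<open>A total variant of \<open>hd\<close>: the value of \<open>hd []\<close> is unspecified
  and need not have a known code, whereas \<open>num 0\<close> has one.\<close>

definition hd0 :: "'a::numbered list \<Rightarrow> 'a" where
  "hd0 xs = (case xs of [] \<Rightarrow> num 0 | x # _ \<Rightarrow> x)"

lemma hd0_Cons [simp]: "hd0 (x # xs) = x"
  by (simp add: hd0_def)

lemma computable_hd0 [computable_intros]:
  assumes "computable f"
  shows "computable (\<lambda>x. hd0 (f x))"
proof -
  have "computable (\<lambda>n :: nat. if n = 0 then 0 else fst (prod_decode (n - 1)))"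
    by (intro computable_intros)
  then have "computable (hd0 :: 'b list \<Rightarrow> 'b)"
    unfolding computable_nat_iff
  proof (rule computableI)
    show "num (if n = 0 then 0 else fst (prod_decode (n - 1))) = (hd0 (num n) :: 'b)" for n
      by (cases n) (auto simp: num_list_def hd0_def split: prod.splits)
  qed
  then show ?thesis using assms by (rule computable_comp)
qed

lemma computable_tl [computable_intros]:
  assumes "computable f"
  shows "computable (\<lambda>x. tl (f x))"
proof -
  have "computable (\<lambda>n :: nat. if n = 0 then 0 else snd (prod_decode (n - 1)))"
    by (intro computable_intros)
  then have "computable (tl :: 'b list \<Rightarrow> 'b list)"
    unfolding computable_nat_iff
  proof (rule computableI)
    show "num (if n = 0 then 0 else snd (prod_decode (n - 1))) = (tl (num n) :: 'b list)" for n
      by (cases n) (auto simp: num_list_def split: prod.splits)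
  qed
  then show ?thesis using assms by (rule computable_comp)
qed

lemma computable_Nil [computable_intros]: "computable (\<lambda>_. [])"
  using computable_num[of 0, where 'b = "'b list"] by (simp add: num_list_def)

lemma computable_Cons [computable_intros]:
  assumes "computable f" "computable g"
  shows "computable (\<lambda>x. f x # g x)"
proof -
  obtain f' g' where "recf f'" "\<And>n. num (f' n) = f (num n)" "recf g'" "\<And>n. num (g' n) = g (num n)"
    using assms unfolding computable_def by metis
  then show ?thesis
    by (intro computableI[OF recf.comp[OF recf.Suc recf.pair[of f' g']]]) (auto simp: num_list_def)
qed

text \<open>The number of tapes is fixed for each machine, so maps over tapes are unrolled to a
  fixed length and no recursion over coded lists has to be shown computable.\<close>

primrec map_upto :: "nat \<Rightarrow> ('a::numbered \<Rightarrow> 'b) \<Rightarrow> 'a list \<Rightarrow> 'b list" where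
  "map_upto 0 f xs = []"
| "map_upto (Suc k) f xs = f (hd0 xs) # map_upto k f (tl xs)"

primrec map2_upto :: "nat \<Rightarrow> ('a::numbered \<Rightarrow> 'b::numbered \<Rightarrow> 'c) \<Rightarrow> 'a list \<Rightarrow> 'b list \<Rightarrow> 'c list" where
  "map2_upto 0 f xs ys = []"
| "map2_upto (Suc k) f xs ys = f (hd0 xs) (hd0 ys) # map2_upto k f (tl xs) (tl ys)"

lemma map_upto_eq_map: "length xs = k \<Longrightarrow> map_upto k f xs = map f xs"
  by (induction k arbitrary: xs) (auto simp: length_Suc_conv)

lemma map2_upto_eq_map2: "length xs = k \<Longrightarrow> length ys = k \<Longrightarrow> map2_upto k f xs ys = map2 f xs ys"
  by (induction k arbitrary: xs ys) (auto simp: length_Suc_conv)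

lemma computable_map_upto [computable_intros]:
  assumes "computable f" "computable g"
  shows "computable (\<lambda>x. map_upto k f (g x))"
  using assms(2)
proof (induction k arbitrary: g)
  case 0
  show ?case by (simp add: computable_intros)
next
  case (Suc k)
  show ?case unfolding map_upto.simps
    by (intro computable_intros Suc computable_comp[OF assms(1)])
qed

lemma computable_map2_upto [computable_intros]:
  assumes f: "computable (\<lambda>p. f (fst p) (snd p))" and "computable g" "computable h"
  shows "computable (\<lambda>x. map2_upto k f (g x) (h x))"
  using assms(2,3)
proof (induction k arbitrary: g h)
  case 0
  show ?case by (simp add: computable_intros)
next
  case (Suc k)
  have "computable (\<lambda>x. f (hd0 (g x)) (hd0 (h x)))"
    using computable_comp[OF f computable_Pair[OF computable_hd0[OF Suc.prems(1)] computable_hd0[OF Suc.prems(2)]]]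
    by simp
  then show ?case unfolding map2_upto.simps
    by (intro computable_intros Suc)
qed

section \<open>Finite tables as computable functions\<close>

lemma inj_num_nat: "inj (num :: nat \<Rightarrow> nat)" and surj_num_nat: "surj (num :: nat \<Rightarrow> nat)"
  by (auto simp: num_nat_def inj_def surj_def)

lemma inj_num_prod:
  assumes "inj (num :: nat \<Rightarrow> 'a::numbered)" "inj (num :: nat \<Rightarrow> 'b::numbered)"
  shows "inj (num :: nat \<Rightarrow> 'a \<times> 'b)"
  using inj_compose[OF prod.inj_map[OF assms] inj_prod_decode[of UNIV]]
  by (simp add: num_prod_def[abs_def] comp_def)

lemma surj_num_prod:
  assumes "surj (num :: nat \<Rightarrow> 'a::numbered)" "surj (num :: nat \<Rightarrow> 'b::numbered)"
  shows "surj (num :: nat \<Rightarrow> 'a \<times> 'b)"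
  using comp_surj[OF surj_prod_decode map_prod_surj[OF assms]]
  by (simp add: num_prod_def[abs_def] comp_def)

lemma inj_num_list:
  assumes "inj (num :: nat \<Rightarrow> 'a::numbered)"
  shows "inj (num :: nat \<Rightarrow> 'a list)"
  using inj_compose[OF list.inj_map[OF assms] inj_list_decode[of UNIV]]
  by (simp add: num_list_def[abs_def] comp_def)

lemma surj_num_list:
  assumes "surj (num :: nat \<Rightarrow> 'a::numbered)"
  shows "surj (num :: nat \<Rightarrow> 'a list)"
proof -
  have "\<exists>zs. map num zs = ys" for ys :: "'a list"
    by (rule exI[of _ "map (inv num) ys"]) (simp add: surj_f_inv_f[OF assms] map_idI)
  then have "surj (map num :: nat list \<Rightarrow> 'a list)" by (metis surjI)
  from comp_surj[OF surj_list_decode this] show ?thesis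
    by (simp add: num_list_def[abs_def] comp_def)
qed

text \<open>Injectivity leaves the finite set \<open>A\<close> with finitely many codes, and
  surjectivity gives every table value a code.\<close>

lemma computable_finite_support:
  fixes F :: "'a::numbered \<Rightarrow> 'b::numbered"
  assumes "inj (num :: nat \<Rightarrow> 'a)" "surj (num :: nat \<Rightarrow> 'b)" "finite A"
  shows "computable (\<lambda>x. if x \<in> A then F x else num 0)"
proof -
  define g where "g n = (if num n \<in> A then inv num (F (num n)) else 0)" for n
  have "finite (num -` A)"
    using assms(1,3) by (simp add: finite_vimageI)
  then have "finite {n. g n \<noteq> 0}"
    by (rule rev_finite_subset) (auto simp: g_def)
  then show ?thesis
    by (intro computableI[OF recf_finite_support]) (auto simp: g_def surj_f_inv_f[OF assms(2)])
qed

text \<open>A half-tape is coded by iterated pairs. Since 0 decodes to \<open>(0, 0)\<close>, it stands for the blank half-tape.\<close>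

definition stack_nth :: "nat \<Rightarrow> nat \<Rightarrow> nat" where
  "stack_nth s j = fst (prod_decode (((\<lambda>n. snd (prod_decode n)) ^^ j) s))"

lemma prod_decode_0: "prod_decode 0 = (0, 0)"
  by (simp add: prod_decode_def prod_decode_aux.simps)

lemma stack_nth_0 [simp]: "stack_nth s 0 = fst (prod_decode s)"
  by (simp add: stack_nth_def)

lemma stack_nth_Suc [simp]: "stack_nth s (Suc j) = stack_nth (snd (prod_decode s)) j"
  by (simp add: stack_nth_def funpow_Suc_right del: funpow.simps)

lemma stack_nth_empty [simp]: "stack_nth 0 j = 0"
  by (induction j) (simp_all add: prod_decode_0)

type_synonym coded_tape = "nat \<times> nat \<times> nat"

text \<open>The code consists of the part to the left of the head, read leftwards, the scanned symbol, and
  the part to the right of the head. The head position itself is not recorded.\<close>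

definition codes_tape :: "coded_tape \<Rightarrow> tape \<Rightarrow> bool" where
  "codes_tape T T' \<longleftrightarrow> fst (snd T) = scanned T' \<and>
     (\<forall>j. fst T' (snd T' + 1 + int j) = stack_nth (snd (snd T)) j) \<and>
     (\<forall>j. fst T' (snd T' - 1 - int j) = stack_nth (fst T) j)"

fun move_code :: "move \<Rightarrow> nat" where
  "move_code Stay = 0" | "move_code MoveLeft = 1" | "move_code MoveRight = 2"

text \<open>A move pushes the written symbol onto the half-tape left behind and pops the new scanned
  symbol from the other one. Popping 0 gives a blank and 0 again, so the tape never ends.\<close>

definition update_coded :: "nat \<times> nat \<Rightarrow> coded_tape \<Rightarrow> coded_tape" where
  "update_coded a T =
    (if snd a = 0 then (fst T, fst a, snd (snd T))
     else if snd a = 1 then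
       (snd (prod_decode (fst T)), fst (prod_decode (fst T)), prod_encode (fst a, snd (snd T)))
     else (prod_encode (fst a, fst T), fst (prod_decode (snd (snd T))), snd (prod_decode (snd (snd T)))))"

lemma codes_tape_update:
  assumes "codes_tape T T'"
  shows "codes_tape (update_coded (s, move_code d) T) (update_tape (s, d) T')"
proof -
  obtain L x R c h where [simp]: "T = (L, x, R)" "T' = (c, h)" by (metis prod_cases3 surj_pair)
  have x: "x = c h" and R: "c (h + 1 + int j) = stack_nth R j" and L: "c (h - 1 - int j) = stack_nth L j" for j
    using assms by (auto simp: codes_tape_def)
  have R': "c (h + 2 + int j) = stack_nth (snd (prod_decode R)) j" for j
    using R[of "Suc j"] by (simp add: algebra_simps)
  have L': "c (h - 2 - int j) = stack_nth (snd (prod_decode L)) j" for j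
    using L[of "Suc j"] by (simp add: algebra_simps)
  show ?thesis
  proof (cases d)
    case Stay
    then show ?thesis using x R L by (simp add: codes_tape_def update_coded_def)
  next
    case MoveLeft
    have "(c(h := s)) (h - 1 + 1 + int j) = stack_nth (prod_encode (s, R)) j" for j
      using R[of "j - 1"] by (cases j) (auto simp: algebra_simps)
    moreover have "(c(h := s)) (h - 1 - 1 - int j) = stack_nth (snd (prod_decode L)) j" for j
      using L'[of j] by (simp add: algebra_simps)
    ultimately show ?thesis
      using MoveLeft L[of 0] by (simp add: codes_tape_def update_coded_def)
  next
    case MoveRight
    have "(c(h := s)) (h + 1 - 1 - int j) = stack_nth (prod_encode (s, L)) j" for j
      using L[of "j - 1"] by (cases j) (auto simp: algebra_simps)
    moreover have "(c(h := s)) (h + 1 + 1 + int j) = stack_nth (snd (prod_decode R)) j" for j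
      using R'[of j] by (simp add: algebra_simps)
    ultimately show ?thesis
      using MoveRight R[of 0] by (simp add: codes_tape_def update_coded_def)
  qed
qed

type_synonym coded_config = "nat \<times> coded_tape list"

definition codes_config :: "coded_config \<Rightarrow> config \<Rightarrow> bool" where
  "codes_config C c \<longleftrightarrow> fst C = fst c \<and> list_all2 codes_tape (snd C) (snd c)"

text \<open>Cut down to the finitely many legal arguments: elsewhere \<open>delta M\<close> is an
  arbitrary function and may be uncomputable. Well-formed configurations never leave this
  set.\<close>

definition coded_delta :: "tm \<Rightarrow> nat \<times> nat list \<Rightarrow> nat \<times> (nat \<times> nat) list" where
  "coded_delta M x =
    (if x \<in> {..<nstates M} \<times> {ss. set ss \<subseteq> {..<nsyms M} \<and> length ss = ntapes M}
     then map_prod id (map (map_prod id move_code)) (delta M (fst x) (snd x)) else num 0)"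

definition coded_step :: "tm \<Rightarrow> coded_config \<Rightarrow> coded_config" where
  "coded_step M C =
    (if fst C = 1 then C
     else (fst (coded_delta M (fst C, map_upto (ntapes M) (\<lambda>T. fst (snd T)) (snd C))),
       map2_upto (ntapes M) update_coded
         (snd (coded_delta M (fst C, map_upto (ntapes M) (\<lambda>T. fst (snd T)) (snd C)))) (snd C)))"

lemma computable_coded_delta: "computable (coded_delta M)"
  unfolding coded_delta_def[abs_def]
  by (intro computable_finite_support inj_num_prod inj_num_list inj_num_nat surj_num_prod surj_num_list surj_num_nat
      finite_cartesian_product finite_lessThan finite_lists_length_eq)

lemma computable_coded_step: "computable (coded_step M)"
  unfolding coded_step_def[abs_def] update_coded_def[abs_def]
  by (intro computable_intros computable_comp[OF computable_coded_delta])

lemma codes_config_step: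
  assumes wf: "wf_tm M" "wf_config M c" and C: "codes_config C c"
  shows "codes_config (coded_step M C) (tm_step M c)"
proof (cases "fst c = 1")
  case True
  then show ?thesis using C by (simp add: tm_step_halted coded_step_def codes_config_def)
next
  case False
  obtain q ts Ts where [simp]: "c = (q, ts)" "C = (q, Ts)"
    using C by (cases c; cases C) (auto simp: codes_config_def)
  have q: "q \<noteq> 1" "q < nstates M" and len: "length ts = ntapes M" and Ts: "list_all2 codes_tape Ts ts"
    using False wf(2) C by (auto simp: wf_config_def codes_config_def)
  then have len': "length Ts = ntapes M" by (auto dest: list_all2_lengthD)
  define ss where "ss = map (\<lambda>(c, i). c i) ts"
  have "map (\<lambda>T. fst (snd T)) Ts = ss"
    using Ts unfolding ss_def list_all2_conv_all_nth
    by (intro nth_equalityI) (auto simp: codes_tape_def split_beta)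
  then have ss': "map_upto (ntapes M) (\<lambda>T. fst (snd T)) Ts = ss"
    by (simp add: map_upto_eq_map len')
  have ss: "set ss \<subseteq> {..<nsyms M}" "length ss = ntapes M"
    using wf(2) len by (auto simp: ss_def wf_config_def split_beta)
  obtain q' as where d: "delta M q ss = (q', as)" by force
  have as: "length as = ntapes M"
    using wf(1) q ss d unfolding wf_tm_def by (metis lessThan_iff snd_conv subsetD)
  have D: "coded_delta M (q, ss) = (q', map (map_prod id move_code) as)"
    using ss q by (simp add: coded_delta_def d)
  have "list_all2 codes_tape (map2 update_coded (map (map_prod id move_code) as) Ts) (map2 update_tape as ts)"
    unfolding list_all2_conv_all_nth
  proof (intro conjI allI impI)
    fix i assume "i < length (map2 update_coded (map (map_prod id move_code) as) Ts)"
    then have "i < ntapes M" "codes_tape (Ts ! i) (ts ! i)"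
      using Ts as len' by (auto simp: list_all2_conv_all_nth)
    then show "codes_tape (map2 update_coded (map (map_prod id move_code) as) Ts ! i) (map2 update_tape as ts ! i)"
      using codes_tape_update[of "Ts ! i" "ts ! i" "fst (as ! i)" "snd (as ! i)"] as len len'
      by (simp add: map_prod_def split_beta)
  qed (use as len len' in simp)
  then show ?thesis
    using q by (simp add: codes_config_def coded_step_def ss' D d map2_upto_eq_map2 as len' flip: ss_def)
qed

text \<open>Bijective base-2 numeration with digits 1 for \<open>False\<close> and 2 for
  \<open>True\<close>. Unlike binary notation it gives each string exactly one number, also in the
  presence of leading \<open>False\<close> bits.\<close>

fun bits :: "nat \<Rightarrow> bool list" where
  "bits n = (if n = 0 then [] else bits ((n - 1) div 2) @ [even n])"

declare bits.simps [simp del]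

definition bits_code :: "bool list \<Rightarrow> nat" where
  "bits_code p = foldl (\<lambda>a b. 2 * a + (if b then 2 else 1)) 0 p"

lemma bits_code_inverse: "bits (bits_code p) = p"
proof (induction p rule: rev_induct)
  case Nil
  then show ?case by (simp add: bits_code_def bits.simps)
next
  case (snoc b p)
  then show ?case by (subst bits.simps) (auto simp: bits_code_def)
qed

lemma bits_inverse: "bits_code (bits n) = n"
proof (induction n rule: bits.induct)
  case (1 n)
  show ?case
  proof (cases "n = 0")
    case True
    then show ?thesis by (simp add: bits_code_def bits.simps)
  next
    case False
    then have "bits_code (bits n) = 2 * ((n - 1) div 2) + (if even n then 2 else 1)"
      using 1 by (subst bits.simps) (simp add: bits_code_def)
    then show ?thesis using False by (auto elim!: evenE oddE)
  qed
qed

lemma inj_bits: "inj bits"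
  by (metis bits_inverse injI)

definition bits_fold :: "(bool \<Rightarrow> 'a \<Rightarrow> 'a) \<Rightarrow> 'a \<Rightarrow> nat \<Rightarrow> 'a" where
  "bits_fold f a n = foldr f (bits n) a"

lemma computable_bits_fold:
  fixes f :: "bool \<Rightarrow> 'a::numbered \<Rightarrow> 'a"
  assumes "computable (f True)" "computable (f False)" "computable (\<lambda>_ :: nat. a)"
  shows "computable (bits_fold f a)"
proof -
  let ?F = "\<lambda>u :: nat \<times> 'a. if fst u = 0 then u
    else ((fst u - 1) div 2, if even (fst u) then f True (snd u) else f False (snd u))"
  \<comment> \<open>The last bit is peeled off first, in the order of \<open>foldr\<close>. As the
    remaining number strictly decreases and 0 is a fixed point, n rounds are enough.\<close>
  have "(?F ^^ k) (n, x) = (0, foldr f (bits n) x)" if "n \<le> k" for k n x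
    using that
  proof (induction k arbitrary: n x)
    case 0
    then show ?case by (simp add: bits.simps)
  next
    case (Suc k)
    show ?case
    proof (cases "n = 0")
      case True
      then show ?thesis using Suc.IH[of 0 x] by (simp add: funpow_Suc_right del: funpow.simps)
    next
      case False
      then have "(n - 1) div 2 \<le> k" using Suc.prems by simp
      from Suc.IH[OF this] False bits.simps[of n] show ?thesis
        by (auto simp add: funpow_Suc_right simp del: funpow.simps)
    qed
  qed
  then have "bits_fold f a = (\<lambda>n. snd ((?F ^^ n) (n, a)))"
    by (auto simp: bits_fold_def)
  moreover have "computable (\<lambda>n :: nat. snd ((?F ^^ n) (n, a)))"
    by (intro computable_intros computable_comp[OF assms(1)] computable_comp[OF assms(2)] assms(3))
  ultimately show ?thesis by simp
qed

lemma computable_length_bits [computable_intros]: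
  assumes "computable f"
  shows "computable (\<lambda>x. length (bits (f x)))"
proof -
  have "computable (bits_fold (\<lambda>_. Suc) 0)"
    by (intro computable_bits_fold computable_intros)
  moreover have "bits_fold (\<lambda>_. Suc) 0 n = length (bits n)" for n
  proof -
    have "foldr (\<lambda>_. Suc) p 0 = length p" for p :: "bool list" by (induction p) auto
    then show ?thesis by (simp add: bits_fold_def)
  qed
  ultimately have "computable (\<lambda>n. length (bits n))" by (metis (no_types, lifting) ext)
  then show ?thesis using assms by (rule computable_comp)
qed

definition push_symbol :: "bool \<Rightarrow> nat \<Rightarrow> nat" where
  "push_symbol b s = prod_encode (if b then 2 else 1, s)"

lemma stack_nth_push_symbols:
  "stack_nth (foldr push_symbol p 0) j = (if j < length p then if p ! j then 2 else 1 else 0)"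
  by (induction p arbitrary: j) (auto simp: push_symbol_def nth_Cons split: nat.splits)

text \<open>Decoding the stack of input symbols once yields the scanned symbol and the right
  half-tape; the left half-tape is blank.\<close>

definition coded_init :: "tm \<Rightarrow> nat \<Rightarrow> coded_config" where
  "coded_init M n = (0, (0, prod_decode (bits_fold push_symbol 0 n)) # replicate (ntapes M - 1) (0, 0, 0))"

lemma computable_coded_init: "computable (coded_init M)"
proof -
  have "computable (\<lambda>_ :: nat. replicate k (0, 0, 0) :: coded_tape list)" for k
    by (induction k) (auto intro!: computable_intros)
  moreover have "computable (bits_fold push_symbol 0)"
    unfolding push_symbol_def[abs_def] by (intro computable_bits_fold) (auto intro!: computable_intros)
  ultimately show ?thesis
    unfolding coded_init_def[abs_def] by (intro computable_intros)
qed

lemma codes_config_init: "codes_config (coded_init M n) (tm_init M (bits n))"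
proof -
  let ?s = "bits_fold push_symbol 0 n"
  have "fst (prod_decode ?s) = stack_nth ?s 0" by simp
  moreover have "stack_nth (snd (prod_decode ?s)) j = stack_nth ?s (Suc j)" for j by simp
  ultimately have "codes_tape (0, prod_decode ?s) (input_tape (bits n))"
    unfolding codes_tape_def input_tape_def
    by (auto simp add: bits_fold_def stack_nth_push_symbols nat_add_distrib simp del: stack_nth_0 stack_nth_Suc)
  moreover have "codes_tape (0, 0, 0) blank_tape"
    by (simp add: codes_tape_def blank_tape_def)
  ultimately show ?thesis
    by (auto simp: codes_config_def coded_init_def tm_init_def list_all2_conv_all_nth nth_Cons split: nat.splits)
qed

lemma codes_config_run:
  assumes "wf_tm M"
  shows "codes_config ((coded_step M ^^ t) (coded_init M n)) (tm_run M (bits n) t)"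
  by (induction t) (simp_all add: tm_run_0 tm_run_Suc codes_config_init codes_config_step wf_config_run assms)

text \<open>The time bound makes the simulation an iteration of a computable step, hence total.
  Inputs are passed as numbers through \<open>bits\<close>.\<close>

theorem decidable_halts_within:
  assumes "wf_tm M" "computable f" "computable g"
  shows "decidable (\<lambda>x. fst (tm_run M (bits (f x)) (g x)) = 1)"
proof -
  have "fst (tm_run M (bits n) t) = fst ((coded_step M ^^ t) (coded_init M n))" for n t
    using codes_config_run[OF assms(1)] by (auto simp: codes_config_def)
  moreover have "decidable (\<lambda>x. fst ((coded_step M ^^ g x) (coded_init M (f x))) = 1)"
    by (intro computable_intros computable_comp[OF computable_coded_step] computable_comp[OF computable_coded_init] assms(2,3))
  ultimately show ?thesis by simp
qed

section \<open>The halting probability\<close>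

text \<open>Induction on the maximal length: unless the empty string is the only element, removing
  the first bit splits \<open>A\<close> into two prefix-free sets of weight at most 1, each of which
  counts half.\<close>

lemma kraft_inequality:
  fixes A :: "bool list set"
  assumes "finite A" "\<And>p q. p \<in> A \<Longrightarrow> q \<in> A \<Longrightarrow> prefix p q \<Longrightarrow> p = q"
  shows "(\<Sum>p\<in>A. 1 / 2 ^ length p :: real) \<le> 1"
proof -
  obtain n where n: "\<And>p. p \<in> A \<Longrightarrow> length p \<le> n"
    using finite_nat_set_iff_bounded_le[of "length ` A"] assms(1) by auto
  from assms n show ?thesis
  proof (induction n arbitrary: A)
    case 0
    then have "A \<subseteq> {[]}" by auto
    then have "A = {} \<or> A = {[]}" by auto
    then show ?case by auto
  next
    case (Suc n)
    show ?case
    proof (cases "[] \<in> A")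
      case True
      then have "A = {[]}" using Suc.prems(2)[of "[]"] by auto
      then show ?thesis by simp
    next
      case False
      define B where "B b = (\<lambda>p. b # p) -` A" for b
      have A: "A = (\<Union>b. (\<lambda>p. b # p) ` B b)"
      proof
        show "A \<subseteq> (\<Union>b. (\<lambda>p. b # p) ` B b)"
        proof
          fix p assume "p \<in> A"
          then show "p \<in> (\<Union>b. (\<lambda>p. b # p) ` B b)" using False by (cases p) (auto simp: B_def)
        qed
      qed (auto simp: B_def)
      have fin: "finite (B b)" for b
        unfolding B_def using Suc.prems(1) by (intro finite_vimageI) (auto simp: inj_def)
      have B: "(\<Sum>p\<in>B b. 1 / 2 ^ length p :: real) \<le> 1" for b
      proof (rule Suc.IH[OF fin])
        show "p = q" if "p \<in> B b" "q \<in> B b" "prefix p q" for p q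
          using Suc.prems(2)[of "b # p" "b # q"] that by (auto simp: B_def)
        show "length p \<le> n" if "p \<in> B b" for p
          using Suc.prems(3)[of "b # p"] that by (auto simp: B_def)
      qed
      have "(\<Sum>p\<in>A. 1 / 2 ^ length p :: real) = (\<Sum>b\<in>UNIV. \<Sum>p\<in>(\<lambda>p. b # p) ` B b. 1 / 2 ^ length p)"
        by (subst A, rule sum.UNION_disjoint) (auto simp: fin)
      also have "\<dots> = (\<Sum>b\<in>UNIV. (\<Sum>p\<in>B b. 1 / 2 ^ length p) / 2)"
        by (intro sum.cong refl) (subst sum.reindex, auto simp: inj_on_def sum_divide_distrib mult.commute)
      also have "\<dots> \<le> 1"
        using B[of True] B[of False] by (simp add: UNIV_bool)
      finally show ?thesis .
    qed
  qed
qed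

text \<open>Summability has to be secured first, as \<open>infsum\<close> is 0 by default otherwise;
  Kraft's inequality bounds the finite partial sums.\<close>

lemma halting_probability_has_sum:
  assumes "prefix_free_tm M"
  shows "((\<lambda>p. 1 / 2 ^ length p) has_sum halting_probability M) (tm_dom M)"
proof -
  have "(\<lambda>p. 1 / 2 ^ length p :: real) summable_on tm_dom M"
  proof (rule nonneg_bdd_above_summable_on)
    have "(\<Sum>p\<in>F. 1 / 2 ^ length p :: real) \<le> 1" if "F \<subseteq> tm_dom M" "finite F" for F
      using that assms by (intro kraft_inequality) (auto simp: prefix_free_tm_def)
    then show "bdd_above (sum (\<lambda>p. 1 / 2 ^ length p :: real) ` {F. F \<subseteq> tm_dom M \<and> finite F})"
      by (intro bdd_aboveI[of _ 1]) auto
  qed simp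
  then show ?thesis unfolding halting_probability_def by (rule has_sum_infsum)
qed

text \<open>The single parameter \<open>t\<close> bounds both the code of the program and the
  running time, which makes these sets finite, computable and increasing.\<close>

definition halted :: "tm \<Rightarrow> nat \<Rightarrow> bool list set" where
  "halted M t = {p. bits_code p < t \<and> fst (tm_run M p t) = 1}"

lemma halted_eq_image_bits: "halted M t = bits ` {n \<in> {..<t}. fst (tm_run M (bits n) t) = 1}"
proof
  show "halted M t \<subseteq> bits ` {n \<in> {..<t}. fst (tm_run M (bits n) t) = 1}"
  proof
    fix p assume "p \<in> halted M t"
    then show "p \<in> bits ` {n \<in> {..<t}. fst (tm_run M (bits n) t) = 1}"
      by (intro image_eqI[of _ _ "bits_code p"]) (auto simp: halted_def bits_code_inverse)
  qed
qed (auto simp: halted_def bits_inverse)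

lemma finite_halted: "finite (halted M t)"
  by (simp add: halted_eq_image_bits)

lemma halted_subset_dom: "halted M t \<subseteq> tm_dom M"
  by (auto simp: halted_def tm_dom_def)

lemma halted_mono:
  assumes "t \<le> t'"
  shows "halted M t \<subseteq> halted M t'"
proof
  fix p assume "p \<in> halted M t"
  then have p: "bits_code p < t" "fst (tm_run M p t) = 1" by (simp_all add: halted_def)
  from tm_run_halted[OF p(2) assms] p assms show "p \<in> halted M t'" by (simp add: halted_def)
qed

lemma tm_dom_eq_Union_halted: "tm_dom M = (\<Union>t. halted M t)"
proof
  show "tm_dom M \<subseteq> (\<Union>t. halted M t)"
  proof
    fix p assume "p \<in> tm_dom M"
    then obtain t where t: "fst (tm_run M p t) = 1" by (auto simp: tm_dom_def)
    then have "fst (tm_run M p (t + Suc (bits_code p))) = 1"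
      using tm_run_halted[OF t, of "t + Suc (bits_code p)"] by simp
    then show "p \<in> (\<Union>t. halted M t)"
      by (auto simp: halted_def intro!: exI[of _ "t + Suc (bits_code p)"])
  qed
qed (use halted_subset_dom in auto)

definition halting_sum :: "tm \<Rightarrow> nat \<Rightarrow> real" where
  "halting_sum M t = (\<Sum>p\<in>halted M t. 1 / 2 ^ length p)"

text \<open>The sets \<open>halted M t\<close> are eventually above every finite subset of the
  domain, so their sums form a subsequence of the net that defines the infinite sum.\<close>

lemma halting_sum_tendsto:
  assumes "prefix_free_tm M"
  shows "halting_sum M \<longlonglongrightarrow> halting_probability M"
proof -
  have "filterlim (halted M) (finite_subsets_at_top (tm_dom M)) sequentially"
    unfolding filterlim_finite_subsets_at_top
  proof (intro allI impI)
    fix F assume F: "finite F \<and> F \<subseteq> tm_dom M"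
    then have "finite F" "F \<subseteq> tm_dom M" by auto
    then have "\<exists>t. F \<subseteq> halted M t"
    proof (induction F rule: finite_induct)
      case (insert p F)
      then obtain t where t: "F \<subseteq> halted M t" by auto
      obtain t' where "p \<in> halted M t'" using insert.prems tm_dom_eq_Union_halted[of M] by auto
      with t have "insert p F \<subseteq> halted M (max t t')"
        using halted_mono[of t "max t t'" M] halted_mono[of t' "max t t'" M] by auto
      then show ?case ..
    qed simp
    then obtain t where "F \<subseteq> halted M t" ..
    then show "\<forall>\<^sub>F t in sequentially. finite (halted M t) \<and> F \<subseteq> halted M t \<and> halted M t \<subseteq> tm_dom M"
      unfolding eventually_sequentially using halted_mono[of t] finite_halted halted_subset_dom by blast
  qed
  from filterlim_compose[OF halting_probability_has_sum[OF assms, unfolded has_sum_def] this]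
  show ?thesis by (simp add: halting_sum_def[abs_def])
qed

text \<open>A program of length at most \<open>n\<close> that has not halted yet contributes at least \<open>2\<^sup>-\<^sup>n\<close> to the rest.\<close>

lemma halted_if_halting_sum_close:
  assumes "prefix_free_tm M" and close: "halting_probability M - halting_sum M t < 1 / 2 ^ n"
    and p: "p \<in> tm_dom M" "length p \<le> n"
  shows "p \<in> halted M t"
proof (rule ccontr)
  assume "p \<notin> halted M t"
  then have "halting_sum M t + 1 / 2 ^ length p = (\<Sum>p\<in>insert p (halted M t). 1 / 2 ^ length p)"
    by (simp add: halting_sum_def finite_halted)
  also have "\<dots> \<le> halting_probability M"
    using halted_subset_dom[of M t] p(1) finite_halted
    by (intro finite_sum_le_has_sum[OF halting_probability_has_sum[OF assms(1)]]) auto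
  finally show False
    using close p(2) by (smt (verit) frac_le power_increasing zero_less_power)
qed

lemma computable_halting_sum:
  assumes "wf_tm M"
  shows "computable (\<lambda>t. of_real (halting_sum M t) :: complex)"
proof -
  have "halting_sum M t = (\<Sum>n<t. if fst (tm_run M (bits n) t) = 1 then 1 / 2 ^ length (bits n) else 0)" for t
  proof -
    have "halting_sum M t = (\<Sum>n\<in>{n\<in>{..<t}. fst (tm_run M (bits n) t) = 1}. 1 / 2 ^ length (bits n))"
      by (simp add: halting_sum_def halted_eq_image_bits sum.reindex inj_on_subset[OF inj_bits])
    then show ?thesis by (simp only: sum.inter_filter[OF finite_lessThan])
  qed
  \<comment> \<open>One half takes the form \<open>inverse (of_nat (Suc 1))\<close> to match
    \<open>computable_inverse_Suc\<close>.\<close>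
  then have "(\<lambda>t. of_real (halting_sum M t)) =
      (\<lambda>t. \<Sum>n<t. if fst (tm_run M (bits n) t) = 1 then inverse (of_nat (Suc 1)) ^ length (bits n) else (0 :: complex))"
    by (auto simp: fun_eq_iff power_one_over inverse_eq_divide intro!: sum.cong)
  moreover have "computable (\<lambda>t. \<Sum>n<t. if fst (tm_run M (bits n) t) = 1
      then inverse (of_nat (Suc 1)) ^ length (bits n) else (0 :: complex))"
    by (intro computable_intros decidable_halts_within assms)
  ultimately show ?thesis by (simp only:)
qed

lemma computable_halting_time_bound:
  assumes M: "prefix_free_tm M" and "computable_number (of_real (halting_probability M))"
  obtains T where "recf T" "\<And>m p. p \<in> tm_dom M \<Longrightarrow> length p \<le> 2 * m \<Longrightarrow> fst (tm_run M p (T m)) = 1"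
proof -
  let ?\<Omega> = "halting_probability M"
  obtain c :: "nat \<Rightarrow> complex" and K where c: "computable c" "\<And>n. cmod (c n - of_real ?\<Omega>) \<le> K * (1 / 2) ^ n"
    using assms(2) unfolding computable_number_def by blast
  \<comment> \<open>\<open>K\<close> may be uncomputable; a natural number above it can enter the
    algorithm as a constant.\<close>
  obtain N :: nat where N: "K \<le> real N" using real_arch_simple by blast
  have cN: "\<bar>Re (c t) - ?\<Omega>\<bar> \<le> real N * (1 / 2) ^ t" for t
  proof -
    have "\<bar>Re (c t) - ?\<Omega>\<bar> \<le> cmod (c t - of_real ?\<Omega>)"
      using abs_Re_le_cmod[of "c t - of_real ?\<Omega>"] by simp
    also have "\<dots> \<le> K * (1 / 2) ^ t" by (rule c(2))
    also have "\<dots> \<le> real N * (1 / 2) ^ t" using N by (intro mult_right_mono) auto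
    finally show ?thesis .
  qed
  let ?h = "inverse (of_nat (Suc 1)) :: complex"
  have h: "Re (?h ^ k) = (1 / 2) ^ k" for k
  proof -
    have "?h = of_real (1 / 2)" by simp
    then show ?thesis by (metis Re_complex_of_real of_real_power)
  qed
  \<comment> \<open>\<open>Re (c t) + N * (1 / 2) ^ t\<close> bounds the halting probability from
    above, so a negative real part of \<open>D m t\<close> certifies that the remainder at time
    \<open>t\<close> is below \<open>(1 / 2) ^ (2 * m)\<close>. All terms are Gaussian rationals, so
    the certificate can be tested.\<close>
  define D where "D m t = c t + of_nat N * ?h ^ t - of_real (halting_sum M t) - ?h ^ (2 * m)" for m t :: nat
  have Re_D: "Re (D m t) = Re (c t) + real N * (1 / 2) ^ t - halting_sum M t - (1 / 2) ^ (2 * m)" for m t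
  proof -
    have "Re (of_nat N * z) = real N * Re z" for z by simp
    then show ?thesis unfolding D_def minus_complex.sel plus_complex.sel h by simp
  qed
  have ex: "\<exists>t. Re (D m t) < 0" for m
  proof -
    \<comment> \<open>The factor 2: the upper estimate adds the error bound to an approximation that
      may already be too large by as much.\<close>
    have "(\<lambda>t. ?\<Omega> - halting_sum M t + 2 * real N * (1 / 2) ^ t) \<longlonglongrightarrow> ?\<Omega> - ?\<Omega> + 2 * real N * 0"
      by (intro tendsto_intros halting_sum_tendsto[OF M] LIMSEQ_power_zero) simp
    then have "eventually (\<lambda>t. ?\<Omega> - halting_sum M t + 2 * real N * (1 / 2) ^ t < (1 / 2) ^ (2 * m)) sequentially"
      by (intro order_tendstoD(2)) auto
    then obtain t where "?\<Omega> - halting_sum M t + 2 * real N * (1 / 2) ^ t < (1 / 2) ^ (2 * m)"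
      using eventually_happens by force
    then have "Re (D m t) < 0" using cN[of t] unfolding Re_D by linarith
    then show ?thesis ..
  qed
  define T where "T m = (LEAST t. Re (D m t) < 0)" for m
  have "wf_tm M" using M by (simp add: prefix_free_tm_def)
  then have "computable T"
    unfolding T_def[abs_def] using ex
    by (intro computable_Least decidable_Re_neg)
      (auto simp only: D_def intro!: computable_intros computable_comp[OF c(1)] computable_comp[OF computable_halting_sum])
  then have "recf T" by (simp add: computable_nat_iff)
  moreover have "fst (tm_run M p (T m)) = 1" if "p \<in> tm_dom M" "length p \<le> 2 * m" for m p
  proof -
    have "Re (D m (T m)) < 0" unfolding T_def by (rule LeastI_ex[OF ex])
    then have "?\<Omega> - halting_sum M (T m) < (1 / 2) ^ (2 * m)"
      using cN[of "T m"] unfolding Re_D by linarith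
    then have "p \<in> halted M (T m)"
      using that by (intro halted_if_halting_sum_close[OF M, of _ "2 * m"]) (auto simp: power_one_over)
    then show ?thesis by (simp add: halted_def)
  qed
  ultimately show thesis by (rule that)
qed

theorem not_computable_number_halting_probability:
  assumes "universal_prefix_free_tm U"
  shows "\<not> computable_number (of_real (halting_probability U))"
proof
  assume "computable_number (of_real (halting_probability U))"
  moreover have U: "prefix_free_tm U" using assms by (simp add: universal_prefix_free_tm_def)
  ultimately obtain T where T: "recf T"
    "\<And>m p. p \<in> tm_dom U \<Longrightarrow> length p \<le> 2 * m \<Longrightarrow> fst (tm_run U p (T m)) = 1"
    using computable_halting_time_bound by blast
  \<comment> \<open>The summand 1 makes the output strictly longer than anything \<open>U\<close>
    can print from a program of length at most 2m in \<open>T m\<close> steps.\<close>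
  have "computable (\<lambda>m. 2 * m + T m + 1)"
    using T(1) by (intro computable_intros) (simp add: computable_nat_iff)
  then obtain M where M: "prefix_free_tm M"
    "\<And>m. \<exists>out. replicate m True @ [False] \<in> tm_dom M \<and>
       tm_output M (replicate m True @ [False]) = Some out \<and> length out \<ge> 2 * m + T m + 1"
    unfolding computable_nat_iff by (rule recf_realized_by_prefix_free_tm) blast
  obtain k where k: "\<And>p. p \<in> tm_dom M \<Longrightarrow> \<exists>q\<in>tm_dom U. tm_output U q = tm_output M p \<and> length q \<le> length p + k"
    using assms M(1) unfolding universal_prefix_free_tm_def by blast
  \<comment> \<open>The least value with m + 1 + k at most 2m, where m + 1 is the length of the
    input given to \<open>M\<close>.\<close>
  define m where "m = Suc k"
  obtain out where out: "replicate m True @ [False] \<in> tm_dom M"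
    "tm_output M (replicate m True @ [False]) = Some out" "length out \<ge> 2 * m + T m + 1"
    using M(2) by blast
  obtain q where q: "q \<in> tm_dom U" "tm_output U q = Some out" "length q \<le> 2 * m"
    using k[OF out(1)] out(2) by (auto simp: m_def)
  have "wf_tm U" using U by (simp add: prefix_free_tm_def)
  from length_tm_output_le[OF this T(2)[OF q(1,3)]] obtain out'
    where "tm_output U q = Some out'" "length out' \<le> length q + T m" .
  with q(2,3) out(3) show False by simp
qed

theorem mainTheorem6:
  fixes U :: tm
  assumes "universal_prefix_free_tm U"
  shows "complex_of_real (halting_probability U) \<notin> EML_R \<and>
         \<not> (\<exists>\<phi>. eml_value \<phi> = Some (complex_of_real (halting_probability U)))"
proof -
  have "\<not> (\<exists>\<phi>. eml_value \<phi> = Some (complex_of_real (halting_probability U)))"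
    using not_computable_number_halting_probability[OF assms] computable_number_eml_value by metis
  then show ?thesis by (simp add: EML_R_def EML_def)
qed

end
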